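(* Let $(R,\mathfrak{m},\mathscr{k})$ be a Cohen--Macaulay local ring of prime characteristic $p>0$. Then $R$ is $F$-injective if there exists a binary numerical function $\varphi_R:(\mathbb{N}\cup\{\infty\})^2\to\mathbb{N}\cup\{\infty\}$ such that for all $x\in R$ and every parameter ideal $I\subseteq R$, \[ \min_{e\geq \operatorname{fte}(I)}\{\operatorname{ord}_{R/I^{[p^e]}}(x^{p^e})\}\leq\varphi_R\big(\ell_R(R/I),\ \operatorname{ord}_{R/I}(x)\big). \]
   Context: An $n$-ary numerical function is a function $\varphi:(\mathbb{N}\cup\{\infty\})^n\to\mathbb{N}\cup\{\infty\}$ with $\varphi(a_1,\dots,a_n)=\infty$ iff some $a_i=\infty$. For a local ring $(S,\mathfrak{n})$, $\operatorname{ord}_S(x)=\sup\{n\mid x\in\mathfrak{n}^n\}$; for an ideal $J\subseteq R$, $\operatorname{ord}_{R/J}(y)$ is the order of the image of $y$ in $R/J$. A parameter ideal is one generated by a system of parameters. $I^{[p^e]}=(r^{p^e}\mid r\in I)$ and $I^F=\{r\mid r^{p^e}\in I^{[p^e]}\text{ for all }e\gg0\}$. The Frobenius test exponent $\operatorname{fte}(I)$ is the smallest $e_0$ such that $(I^F)^{[p^e]}=I^{[p^e]}$ for all $e\ge e_0$. $R$ is $F$-injective if the Frobenius maps $F:H^i_\mathfrak{m}(R)\to H^i_\mathfrak{m}(F_*R)$ on local cohomology are injective for all $0\le i\le\dim R$. *)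

theory Defs
  imports Main "HOL-Library.Extended_Nat" "HOL-Computational_Algebra.Primes"
begin

definition is_ideal :: "'a::comm_ring_1 set \<Rightarrow> bool" where
  "is_ideal I \<longleftrightarrow> 0 \<in> I \<and> (\<forall>a\<in>I. \<forall>b\<in>I. a + b \<in> I) \<and> (\<forall>r. \<forall>a\<in>I. r * a \<in> I)"

definition ideal_gen :: "'a::comm_ring_1 set \<Rightarrow> 'a set" where
  "ideal_gen A = \<Inter>{I. is_ideal I \<and> A \<subseteq> I}"

definition ideal_prod :: "'a::comm_ring_1 set \<Rightarrow> 'a set \<Rightarrow> 'a set" where
  "ideal_prod I J = ideal_gen {a * b | a b. a \<in> I \<and> b \<in> J}"

primrec ideal_pow :: "'a::comm_ring_1 set \<Rightarrow> nat \<Rightarrow> 'a set" where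
  "ideal_pow I 0 = UNIV"
| "ideal_pow I (Suc n) = ideal_prod I (ideal_pow I n)"

definition ideal_sum :: "'a::comm_ring_1 set \<Rightarrow> 'a set \<Rightarrow> 'a set" where
  "ideal_sum I J = {a + b | a b. a \<in> I \<and> b \<in> J}"

definition radical :: "'a::comm_ring_1 set \<Rightarrow> 'a set" where
  "radical I = {r. \<exists>n. r ^ n \<in> I}"

definition prime_ideal :: "'a::comm_ring_1 set \<Rightarrow> bool" where
  "prime_ideal P \<longleftrightarrow> is_ideal P \<and> P \<noteq> UNIV \<and> (\<forall>a b. a * b \<in> P \<longrightarrow> a \<in> P \<or> b \<in> P)"

definition noetherian_ring :: "'a::comm_ring_1 itself \<Rightarrow> bool" where
  "noetherian_ring _ \<longleftrightarrow> (\<forall>I::'a set. is_ideal I \<longrightarrow> (\<exists>F. finite F \<and> I = ideal_gen F))"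

definition local_ring :: "'a::comm_ring_1 set \<Rightarrow> bool" where
  "local_ring m \<longleftrightarrow> noetherian_ring TYPE('a) \<and> is_ideal m \<and> m \<noteq> UNIV \<and>
     (\<forall>I. is_ideal I \<and> I \<noteq> UNIV \<longrightarrow> I \<subseteq> m)"

definition krull_dim :: "'a::comm_ring_1 itself \<Rightarrow> enat" where
  "krull_dim _ = Sup {enat n | n. \<exists>P :: nat \<Rightarrow> 'a set.
      (\<forall>i\<le>n. prime_ideal (P i)) \<and> (\<forall>i<n. P i \<subset> P (Suc i))}"

definition regular_seq :: "'a::comm_ring_1 set \<Rightarrow> (nat \<Rightarrow> 'a) \<Rightarrow> nat \<Rightarrow> bool" where
  "regular_seq m y t \<longleftrightarrow> (\<forall>i<t. y i \<in> m) \<and> ideal_gen (y ` {..<t}) \<noteq> UNIV \<and>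
     (\<forall>i<t. \<forall>r. y i * r \<in> ideal_gen (y ` {..<i}) \<longrightarrow> r \<in> ideal_gen (y ` {..<i}))"

definition depth :: "'a::comm_ring_1 set \<Rightarrow> enat" where
  "depth m = Sup {enat t | t. \<exists>y. regular_seq m y t}"

definition cohen_macaulay_local :: "'a::comm_ring_1 set \<Rightarrow> bool" where
  "cohen_macaulay_local m \<longleftrightarrow> local_ring m \<and> depth m = krull_dim TYPE('a)"

definition system_of_parameters :: "'a::comm_ring_1 set \<Rightarrow> (nat \<Rightarrow> 'a) \<Rightarrow> nat \<Rightarrow> bool" where
  "system_of_parameters m x d \<longleftrightarrow> krull_dim TYPE('a) = enat d \<and> (\<forall>i<d. x i \<in> m) \<and>
     radical (ideal_gen (x ` {..<d})) = m"

definition parameter_ideal :: "'a::comm_ring_1 set \<Rightarrow> 'a set \<Rightarrow> bool" where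
  "parameter_ideal m I \<longleftrightarrow> (\<exists>x d. system_of_parameters m x d \<and> I = ideal_gen (x ` {..<d}))"

text \<open>Length of the R-module R/I: supremum of lengths of strict chains of
  submodules of R/I, i.e. of ideals I = J_0 < J_1 < ... < J_n = R.\<close>
definition length_quot :: "'a::comm_ring_1 set \<Rightarrow> enat" where
  "length_quot I = Sup {enat n | n. \<exists>J :: nat \<Rightarrow> 'a set. J 0 = I \<and> J n = UNIV \<and>
      (\<forall>i\<le>n. is_ideal (J i)) \<and> (\<forall>i<n. J i \<subset> J (Suc i))}"

text \<open>ord_{R/J}(y): the maximal ideal of R/J is m/J and its k-th power is (m^k + J)/J.\<close>
definition ord_quot :: "'a::comm_ring_1 set \<Rightarrow> 'a set \<Rightarrow> 'a \<Rightarrow> enat" where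
  "ord_quot m J y = Sup {enat k | k. y \<in> ideal_sum (ideal_pow m k) J}"

definition frob_pow :: "'a::comm_ring_1 set \<Rightarrow> nat \<Rightarrow> 'a set" where
  "frob_pow I q = ideal_gen ((\<lambda>r. r ^ q) ` I)"

definition frob_closure :: "nat \<Rightarrow> 'a::comm_ring_1 set \<Rightarrow> 'a set" where
  "frob_closure p I = {r. \<exists>e0. \<forall>e\<ge>e0. r ^ (p ^ e) \<in> frob_pow I (p ^ e)}"

definition fte :: "nat \<Rightarrow> 'a::comm_ring_1 set \<Rightarrow> enat" where
  "fte p I = Inf {enat e0 | e0. \<forall>e\<ge>e0. frob_pow (frob_closure p I) (p ^ e) = frob_pow I (p ^ e)}"

definition numerical_fun2 :: "(enat \<Rightarrow> enat \<Rightarrow> enat) \<Rightarrow> bool" where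
  "numerical_fun2 \<phi> \<longleftrightarrow> (\<forall>a b. \<phi> a b = \<infinity> \<longleftrightarrow> a = \<infinity> \<or> b = \<infinity>)"

text \<open>Let x_0,...,x_{n-1} generate m.  The Cech complex has
  C^i = direct sum over i-subsets S of {0..<n} of R_{x_S}, x_S = prod of x_j, j in S.
  A cochain of degree i is represented (over a common exponent k) by a function a with
  components a S / x_S^k.  Equality in R_{x_S} of r/x_S^k and s/x_S^l is the usual one.\<close>

definition prodx :: "(nat \<Rightarrow> 'a::comm_ring_1) \<Rightarrow> nat set \<Rightarrow> 'a" where
  "prodx x S = (\<Prod>j\<in>S. x j)"

definition loc_eq :: "(nat \<Rightarrow> 'a::comm_ring_1) \<Rightarrow> nat set \<Rightarrow> 'a \<times> nat \<Rightarrow> 'a \<times> nat \<Rightarrow> bool" where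
  "loc_eq x S u v \<longleftrightarrow> (\<exists>N. prodx x S ^ N *
      (fst u * prodx x S ^ snd v - fst v * prodx x S ^ snd u) = 0)"

definition faces :: "nat \<Rightarrow> nat \<Rightarrow> nat set set" where
  "faces n i = {S. S \<subseteq> {..<n} \<and> card S = i}"

definition cech_sign :: "nat set \<Rightarrow> nat \<Rightarrow> 'a::comm_ring_1" where
  "cech_sign T j = (- 1) ^ card {t\<in>T. t < j}"

text \<open>Numerator (over x_T^k) of the T-component of the Cech differential of the cochain (a, k).\<close>
definition cech_d :: "(nat \<Rightarrow> 'a::comm_ring_1) \<Rightarrow> nat \<Rightarrow> (nat set \<Rightarrow> 'a) \<Rightarrow> nat set \<Rightarrow> 'a" where
  "cech_d x k a T = (\<Sum>j\<in>T. cech_sign T j * a (T - {j}) * x j ^ k)"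

definition cech_cocycle :: "(nat \<Rightarrow> 'a::comm_ring_1) \<Rightarrow> nat \<Rightarrow> nat \<Rightarrow> (nat set \<Rightarrow> 'a) \<Rightarrow> nat \<Rightarrow> bool" where
  "cech_cocycle x n i a k \<longleftrightarrow> (\<forall>T\<in>faces n (Suc i). loc_eq x T (cech_d x k a T, k) (0, 0))"

definition cech_coboundary :: "(nat \<Rightarrow> 'a::comm_ring_1) \<Rightarrow> nat \<Rightarrow> nat \<Rightarrow> (nat set \<Rightarrow> 'a) \<Rightarrow> nat \<Rightarrow> bool" where
  "cech_coboundary x n i a k \<longleftrightarrow> (case i of
      0 \<Rightarrow> (\<forall>S\<in>faces n 0. loc_eq x S (a S, k) (0, 0))
    | Suc _ \<Rightarrow> (\<exists>b l. \<forall>S\<in>faces n i. loc_eq x S (cech_d x l b S, l) (a S, k)))"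

text \<open>Frobenius on H^i: the class of (a S / x_S^k) goes to the class of (a S^p / x_S^(kp)).
  Injectivity of this additive map on cohomology.\<close>
definition frob_injective_cech :: "nat \<Rightarrow> (nat \<Rightarrow> 'a::comm_ring_1) \<Rightarrow> nat \<Rightarrow> nat \<Rightarrow> bool" where
  "frob_injective_cech p x n i \<longleftrightarrow> (\<forall>a k. cech_cocycle x n i a k \<and>
      cech_coboundary x n i (\<lambda>S. a S ^ p) (k * p) \<longrightarrow> cech_coboundary x n i a k)"

text \<open>F-injective: Frobenius on H^i_m(R) is injective for all 0 <= i <= dim R
  (H^i_m(R) computed by the Cech complex on any finite generating list of m).\<close>
definition F_injective :: "nat \<Rightarrow> 'a::comm_ring_1 set \<Rightarrow> bool" where
  "F_injective p m \<longleftrightarrow> (\<forall>i. enat i \<le> krull_dim TYPE('a) \<longrightarrow>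
      (\<forall>x n. ideal_gen (x ` {..<n}) = m \<longrightarrow> frob_injective_cech p x n i))"

end

theory Submission
  imports Defs
begin

text \<open>If the depth exceeds \<open>i\<close> then \<open>H^i\<close> vanishes, so only \<open>i = d = dim R\<close> matters. There a regular
  sequence \<open>y\<close> of length \<open>d\<close> identifies a class \<open>\<eta>\<close> in \<open>H^d\<close> with an element \<open>r\<close> of \<open>R/I\<close>, where \<open>I\<close> is
  generated by powers of the \<open>y i\<close> and hence is a parameter ideal, by means of iterated connecting
  homomorphisms, which are injective by the vanishing below \<open>d\<close> and compatible with Frobenius. If
  Frobenius kills \<open>\<eta>\<close>, then \<open>r^p \<in> I^[p]\<close>, so the orders of \<open>r^(p^e)\<close> are infinite for \<open>e \<ge> 1\<close>; the
  bound by \<open>\<phi>\<close> then forces \<open>r \<in> I\<close>.\<close>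

section \<open>Ideals\<close>

text \<open>No cohomology module is formed: a connecting homomorphism survives only as a relation
  \<open>y ^ K * a - d b\<close> in \<open>J\<close> between concrete numerators. The exponent
  \<open>K\<close> that kills a class depends on the cocycle, so the quotients are by powers chosen
  along the way, and weak regularity must survive replacing the leading element by a power; closure
  under extensions is proved for this. Frobenius maps \<open>R/J\<close> to \<open>R/J'\<close>,
  where \<open>J'\<close> contains the p-th powers of \<open>J\<close>, so the p-th power of such a
  relation lives over another ideal. The descent therefore runs two towers of quotients side by side
  and needs vanishing on the second. Finally, \<open>\<phi>\<close> is finite only at finite
  arguments, hence the need that \<open>R/I\<close> has finite length and that an element outside
  \<open>I\<close> has finite order in \<open>R/I\<close>.\<close>

lemma is_idealI:
  "\<lbrakk>0 \<in> I; \<And>a b. \<lbrakk>a \<in> I; b \<in> I\<rbrakk> \<Longrightarrow> a + b \<in> I; \<And>r a. a \<in> I \<Longrightarrow> r * a \<in> I\<rbrakk> \<Longrightarrow> is_ideal I"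
  unfolding is_ideal_def by blast

lemma
  assumes "is_ideal I"
  shows ideal_zero: "0 \<in> I"
    and ideal_add: "a \<in> I \<Longrightarrow> b \<in> I \<Longrightarrow> a + b \<in> I"
    and ideal_mult: "a \<in> I \<Longrightarrow> r * a \<in> I"
    and ideal_mult_right: "a \<in> I \<Longrightarrow> a * r \<in> I"
  using assms unfolding is_ideal_def by (auto simp: mult.commute[of a r])

lemma ideal_minus: "is_ideal I \<Longrightarrow> a \<in> I \<Longrightarrow> - a \<in> I"
  using ideal_mult[of I a "-1"] by simp

lemma ideal_diff: "is_ideal I \<Longrightarrow> a \<in> I \<Longrightarrow> b \<in> I \<Longrightarrow> a - b \<in> I"
  using ideal_add[of I a "- b"] ideal_minus by auto

lemma ideal_sum_mem: "is_ideal I \<Longrightarrow> (\<And>j. j \<in> A \<Longrightarrow> f j \<in> I) \<Longrightarrow> sum f A \<in> I"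
  by (induction A rule: infinite_finite_induct) (auto intro: ideal_zero ideal_add)

lemma ideal_pow_mono: "is_ideal I \<Longrightarrow> a ^ k \<in> I \<Longrightarrow> k \<le> l \<Longrightarrow> a ^ l \<in> I"
  by (metis ideal_mult le_add_diff_inverse2 power_add)

lemma ideal_eq_UNIV: "is_ideal I \<Longrightarrow> 1 \<in> I \<Longrightarrow> I = UNIV"
  using ideal_mult[of I 1] by auto

lemma is_ideal_UNIV: "is_ideal UNIV"
  by (rule is_idealI) auto

lemma is_ideal_zero: "is_ideal {0}"
  by (rule is_idealI) auto

lemma is_ideal_gen: "is_ideal (ideal_gen A)"
  unfolding ideal_gen_def by (rule is_idealI) (auto simp: is_ideal_def)

lemma ideal_gen_superset: "A \<subseteq> ideal_gen A"
  unfolding ideal_gen_def by blast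

lemma ideal_gen_least: "is_ideal I \<Longrightarrow> A \<subseteq> I \<Longrightarrow> ideal_gen A \<subseteq> I"
  unfolding ideal_gen_def by blast

lemma ideal_gen_ideal: "is_ideal I \<Longrightarrow> ideal_gen I = I"
  using ideal_gen_least[of I I] ideal_gen_superset[of I] by auto

lemma ideal_gen_empty: "ideal_gen {} = {0}"
  using ideal_gen_least[OF is_ideal_zero, of "{}"] ideal_zero[OF is_ideal_gen, of "{}"] by auto

text \<open>An explicit \<open>J + (y)\<close> for an ideal \<open>J\<close>. Sequences are adjoined
  one element at a time by \<open>foldl\<close>, which matches the recursion along a regular
  sequence.\<close>

definition ideal_adjoin :: "'a::comm_ring_1 set \<Rightarrow> 'a \<Rightarrow> 'a set" where
  "ideal_adjoin J y = {j + r * y | j r. j \<in> J}"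

lemma ideal_adjoinI: "j \<in> J \<Longrightarrow> j + r * y \<in> ideal_adjoin J y"
  unfolding ideal_adjoin_def by blast

lemma ideal_adjoinE:
  assumes "a \<in> ideal_adjoin J y"
  obtains j r where "j \<in> J" "a = j + r * y"
  using assms unfolding ideal_adjoin_def by blast

lemma ideal_adjoin_iff: "a \<in> ideal_adjoin J y \<longleftrightarrow> (\<exists>r. a - r * y \<in> J)"
proof
  show "a \<in> ideal_adjoin J y \<Longrightarrow> \<exists>r. a - r * y \<in> J"
    by (metis ideal_adjoinE add_diff_cancel_right')
  show "\<exists>r. a - r * y \<in> J \<Longrightarrow> a \<in> ideal_adjoin J y"
    by (metis ideal_adjoinI diff_add_cancel)
qed

lemma is_ideal_adjoin:
  assumes "is_ideal J" shows "is_ideal (ideal_adjoin J y)"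
proof (rule is_idealI)
  show "0 \<in> ideal_adjoin J y"
    using ideal_adjoinI[OF ideal_zero[OF assms], of 0 y] by simp
next
  fix a b assume "a \<in> ideal_adjoin J y" "b \<in> ideal_adjoin J y"
  then obtain i r j s where "i \<in> J" "j \<in> J" "a = i + r * y" "b = j + s * y"
    by (metis ideal_adjoinE)
  then show "a + b \<in> ideal_adjoin J y"
    using ideal_adjoinI[OF ideal_add[OF assms, of i j], of "r + s" y] by (simp add: algebra_simps)
next
  fix a s assume "a \<in> ideal_adjoin J y"
  then obtain i r where "i \<in> J" "a = i + r * y" by (metis ideal_adjoinE)
  then show "s * a \<in> ideal_adjoin J y"
    using ideal_adjoinI[OF ideal_mult[OF assms, of i s], of "s * r" y] by (simp add: algebra_simps)
qed

lemma ideal_adjoin_superset: "J \<subseteq> ideal_adjoin J y"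
  using ideal_adjoinI[of _ J 0 y] by auto

lemma ideal_adjoin_self: "is_ideal J \<Longrightarrow> y \<in> ideal_adjoin J y"
  using ideal_adjoinI[of 0 J 1 y] ideal_zero by auto

lemma ideal_adjoin_least:
  "\<lbrakk>is_ideal I; J \<subseteq> I; y \<in> I\<rbrakk> \<Longrightarrow> ideal_adjoin J y \<subseteq> I"
  by (auto elim!: ideal_adjoinE intro!: ideal_add[of I] ideal_mult[of I])

lemma ideal_adjoin_gen: "ideal_adjoin (ideal_gen A) y = ideal_gen (insert y A)"
proof
  show "ideal_adjoin (ideal_gen A) y \<subseteq> ideal_gen (insert y A)"
    by (intro ideal_adjoin_least is_ideal_gen ideal_gen_least)
      (use ideal_gen_superset[of "insert y A"] in auto)
  show "ideal_gen (insert y A) \<subseteq> ideal_adjoin (ideal_gen A) y"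
    by (intro ideal_gen_least is_ideal_adjoin is_ideal_gen)
      (use ideal_gen_superset[of A] ideal_adjoin_superset ideal_adjoin_self[OF is_ideal_gen] in blast)
qed

lemma foldl_adjoin_gen: "foldl ideal_adjoin (ideal_gen A) zs = ideal_gen (A \<union> set zs)"
  by (induction zs arbitrary: A) (auto simp: ideal_adjoin_gen)

text \<open>Sums use Frobenius in place of the binomial theorem: raising to the power
  \<open>?q\<close> is additive, and \<open>?q\<close> exceeds both exponents.\<close>

lemma is_ideal_radical:
  fixes I :: "'a::comm_ring_1 set"
  assumes "prime CHAR('a)" "is_ideal I"
  shows "is_ideal (radical I)"
proof (rule is_idealI)
  show "0 \<in> radical I"
    unfolding radical_def using ideal_zero[OF assms(2)] by (auto intro!: exI[of _ 1])
next
  fix a b assume "a \<in> radical I" "b \<in> radical I"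
  then obtain i j where ij: "a ^ i \<in> I" "b ^ j \<in> I" unfolding radical_def by auto
  let ?q = "CHAR('a) ^ (i + j)"
  have "i + j < ?q"
    by (rule power_gt_expt) (use prime_gt_1_nat[OF assms(1)] in auto)
  then have "a ^ ?q \<in> I" "b ^ ?q \<in> I"
    using ideal_pow_mono[OF assms(2) ij(1), of ?q] ideal_pow_mono[OF assms(2) ij(2), of ?q] by simp_all
  then have "(a + b) ^ ?q \<in> I"
    by (simp add: freshmans_dream'[OF assms(1) refl] ideal_add[OF assms(2)])
  then show "a + b \<in> radical I" unfolding radical_def by blast
next
  fix a r assume "a \<in> radical I"
  then show "r * a \<in> radical I"
    unfolding radical_def using ideal_mult[OF assms(2)] by (auto simp: power_mult_distrib)
qed

lemma radical_mono: "I \<subseteq> J \<Longrightarrow> radical I \<subseteq> radical J"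
  unfolding radical_def by auto

lemma radical_idem: "radical (radical I) = radical I"
proof
  show "radical (radical I) \<subseteq> radical I"
    unfolding radical_def by (auto simp flip: power_mult)
  show "radical I \<subseteq> radical (radical I)"
    unfolding radical_def by (metis (mono_tags, lifting) mem_Collect_eq power_one_right subsetI)
qed

section \<open>Weakly regular sequences\<close>

definition nonzerodivisor_mod :: "'a::comm_ring_1 set \<Rightarrow> 'a \<Rightarrow> bool" where
  "nonzerodivisor_mod J y \<longleftrightarrow> (\<forall>r. y * r \<in> J \<longrightarrow> r \<in> J)"

text \<open>This keeps the nonzerodivisor part of a regular sequence, relative to a base ideal
  \<open>J\<close> so that induction can pass from \<open>J\<close> to
  \<open>J + (y)\<close>.\<close>

fun weakly_regular :: "'a::comm_ring_1 set \<Rightarrow> 'a list \<Rightarrow> bool" where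
  "weakly_regular J [] \<longleftrightarrow> True"
| "weakly_regular J (y # ys) \<longleftrightarrow> nonzerodivisor_mod J y \<and> weakly_regular (ideal_adjoin J y) ys"

text \<open>This is closure under extensions, for the exact sequence
  \<open>0 \<rightarrow> R/(A : u) \<rightarrow> R/A \<rightarrow> R/(A + u) \<rightarrow> 0\<close>.\<close>

lemma weakly_regular_extension:
  assumes "is_ideal A" "weakly_regular {s. u * s \<in> A} ys" "weakly_regular (ideal_adjoin A u) ys"
  shows "weakly_regular A ys"
  using assms
proof (induction ys arbitrary: A)
  case (Cons y ys)
  note A = Cons.prems(1)
  let ?B = "ideal_adjoin A u" and ?C = "{s. u * s \<in> A}"
  have nzC: "u * s \<in> A" if "u * (y * s) \<in> A" for s
    using Cons.prems(2) that by (auto simp: nonzerodivisor_mod_def)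
  have nzB: "r \<in> ?B" if "y * r \<in> ?B" for r
    using Cons.prems(3) that by (auto simp: nonzerodivisor_mod_def)
  have nz: "nonzerodivisor_mod A y"
    unfolding nonzerodivisor_mod_def
  proof (intro allI impI)
    fix r assume r: "y * r \<in> A"
    then obtain a s where as: "a \<in> A" "r = a + s * u"
      using nzB[of r] ideal_adjoin_superset by (metis ideal_adjoinE subsetD)
    have "u * (y * s) = y * r - y * a" using as by (simp add: algebra_simps)
    then have "u * s \<in> A" using nzC ideal_diff[OF A r ideal_mult[OF A as(1)]] by metis
    then show "r \<in> A" using as ideal_add[OF A] by (simp add: mult.commute)
  qed
  have swap: "ideal_adjoin (ideal_adjoin A y) u = ideal_adjoin ?B y"
    using ideal_adjoin_gen[of A] ideal_adjoin_gen[of "insert _ A"]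
    by (simp add: ideal_gen_ideal[OF A] insert_commute)
  \<comment> \<open>\<open>y\<close> is a nonzerodivisor modulo \<open>A + (u)\<close>, so the exact
    sequence stays exact after reduction modulo \<open>y\<close>, and its left term becomes
    \<open>R/((A : u) + y)\<close>.\<close>
  have colon: "{s. u * s \<in> ideal_adjoin A y} = ideal_adjoin ?C y"
  proof safe
    fix s assume "u * s \<in> ideal_adjoin A y"
    then obtain a r where ar: "a \<in> A" "u * s = a + r * y" by (metis ideal_adjoinE)
    have "y * r \<in> ?B"
      using ideal_adjoinI[OF ideal_minus[OF A ar(1)], of s u] ar(2) by (simp add: algebra_simps)
    then obtain a' s' where as: "a' \<in> A" "r = a' + s' * u" using nzB by (metis ideal_adjoinE)
    have "u * (s - s' * y) = a + y * a'" using ar as by (simp add: algebra_simps)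
    then have "s - s' * y \<in> ?C" using ideal_add[OF A ar(1) ideal_mult[OF A as(1)]] by simp
    then show "s \<in> ideal_adjoin ?C y" using ideal_adjoinI[of "s - s' * y" ?C s' y] by simp
  next
    fix s assume "s \<in> ideal_adjoin ?C y"
    then obtain c r where "u * c \<in> A" "s = c + r * y" by (auto elim: ideal_adjoinE)
    then show "u * s \<in> ideal_adjoin A y"
      using ideal_adjoinI[of "u * c" A "u * r" y] by (simp add: algebra_simps)
  qed
  have "weakly_regular (ideal_adjoin A y) ys"
    using Cons.IH[OF is_ideal_adjoin[OF A, of y]] Cons.prems(2,3) swap colon by simp
  with nz show ?case by simp
qed simp

lemma nonzerodivisor_mod_power:
  "nonzerodivisor_mod J y \<Longrightarrow> nonzerodivisor_mod J (y ^ k)"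
  unfolding nonzerodivisor_mod_def by (induction k) (simp, metis mult.assoc power_Suc)

text \<open>In \<open>R/(J + y ^ (k + 2))\<close> the submodule generated by
  \<open>y ^ (k + 1)\<close> is isomorphic to \<open>R/(J + y)\<close>, with quotient
  \<open>R/(J + y ^ (k + 1))\<close>. Closure under extensions gives the induction step.\<close>

lemma weakly_regular_power_hd:
  assumes "is_ideal J" "weakly_regular J (y # ys)" "k > 0"
  shows "weakly_regular J (y ^ k # ys)"
proof -
  have nz: "nonzerodivisor_mod J y" and ys: "weakly_regular (ideal_adjoin J y) ys"
    using assms(2) by auto
  have "weakly_regular (ideal_adjoin J (y ^ Suc k)) ys" for k
  proof (induction k)
    case (Suc k)
    let ?A = "ideal_adjoin J (y ^ Suc (Suc k))"
    have A: "is_ideal ?A" by (rule is_ideal_adjoin[OF assms(1)])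
    have 1: "{s. y ^ Suc k * s \<in> ?A} = ideal_adjoin J y"
    proof safe
      fix s assume "y ^ Suc k * s \<in> ?A"
      then obtain j r where jr: "j \<in> J" "y ^ Suc k * s = j + r * y ^ Suc (Suc k)"
        by (metis ideal_adjoinE)
      then have "y ^ Suc k * (s - r * y) \<in> J" by (simp add: algebra_simps)
      then have "s - r * y \<in> J"
        using nonzerodivisor_mod_power[OF nz, of "Suc k"] unfolding nonzerodivisor_mod_def by blast
      then show "s \<in> ideal_adjoin J y" using ideal_adjoin_iff by blast
    next
      fix s assume "s \<in> ideal_adjoin J y"
      then obtain j r where "j \<in> J" "s = j + r * y" by (auto elim: ideal_adjoinE)
      then show "y ^ Suc k * s \<in> ?A"
        using ideal_adjoinI[OF ideal_mult[OF assms(1), of j "y ^ Suc k"], of r "y ^ Suc (Suc k)"]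
        by (simp add: algebra_simps)
    qed
    have "ideal_adjoin J (y ^ Suc k) \<subseteq> ideal_adjoin ?A (y ^ Suc k)"
      by (intro ideal_adjoin_least is_ideal_adjoin A ideal_adjoin_self
          subset_trans[OF ideal_adjoin_superset ideal_adjoin_superset])
    moreover have "ideal_adjoin ?A (y ^ Suc k) \<subseteq> ideal_adjoin J (y ^ Suc k)"
      by (intro ideal_adjoin_least is_ideal_adjoin assms(1) ideal_adjoin_self ideal_adjoin_superset)
        (unfold power_Suc[of y "Suc k"], intro ideal_mult is_ideal_adjoin assms(1) ideal_adjoin_self)
    ultimately have 2: "ideal_adjoin ?A (y ^ Suc k) = ideal_adjoin J (y ^ Suc k)" by blast
    show ?case
      using weakly_regular_extension[OF A, of "y ^ Suc k"] Suc ys by (simp only: 1 2)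
  qed (use ys in simp)
  then show ?thesis
    using nonzerodivisor_mod_power[OF nz, of k] assms(3) by (cases k) auto
qed

lemma weakly_regular_map_power:
  assumes "is_ideal J" "weakly_regular J ys" "k > 0"
  shows "weakly_regular J (map (\<lambda>y. y ^ k) ys)"
  using assms
proof (induction ys arbitrary: J)
  case (Cons y ys)
  then have "weakly_regular J (y ^ k # ys)" by (intro weakly_regular_power_hd)
  then show ?case using Cons.IH[OF is_ideal_adjoin[OF Cons.prems(1)]] Cons.prems(3) by simp
qed simp

lemma weakly_regular_of_regular_seq:
  assumes "regular_seq m y t"
  shows "weakly_regular {0} (map y [0..<t])"
proof -
  have "weakly_regular (ideal_gen (y ` {..<i})) (map y [i..<t])" if "i \<le> t" for i
    using that
  proof (induction rule: inc_induct)
    case (step i)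
    then have "nonzerodivisor_mod (ideal_gen (y ` {..<i})) (y i)"
      using assms unfolding regular_seq_def nonzerodivisor_mod_def by blast
    with step show ?case
      by (simp add: upt_conv_Cons ideal_adjoin_gen lessThan_Suc)
  qed simp
  from this[of 0] show ?thesis by (simp add: ideal_gen_empty)
qed

section \<open>Cech cochains with coefficients in a quotient\<close>

lemma finite_faces: "finite (faces n i)"
  unfolding faces_def by (rule finite_subset[of _ "Pow {..<n}"]) auto

lemma faces_finite: "S \<in> faces n i \<Longrightarrow> finite S"
  unfolding faces_def by (auto intro: finite_subset)

lemma faces_remove: "T \<in> faces n (Suc i) \<Longrightarrow> j \<in> T \<Longrightarrow> T - {j} \<in> faces n i"
  unfolding faces_def by (auto intro: finite_subset)

lemma faces_insert: "S \<in> faces n i \<Longrightarrow> j < n \<Longrightarrow> j \<notin> S \<Longrightarrow> insert j S \<in> faces n (Suc i)"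
  unfolding faces_def by (auto simp: card_insert_if finite_subset)

lemma prodx_remove: "finite T \<Longrightarrow> j \<in> T \<Longrightarrow> prodx x T = x j * prodx x (T - {j})"
  unfolding prodx_def by (rule prod.remove)

section \<open>Signs, and the square of the Cech differential\<close>

lemma cech_sign_sq: "cech_sign T j * (cech_sign T j * a) = (a :: 'a::comm_ring_1)"
  unfolding cech_sign_def by (simp flip: mult.assoc power_mult_distrib)

lemma cech_sign_remove_self: "cech_sign (T - {j}) j = cech_sign T j"
  unfolding cech_sign_def by (rule arg_cong[where f = "\<lambda>A. (-1) ^ card A"]) auto

text \<open>Deleting the smaller of two indices lowers the position of the larger by one, while
  deleting the larger leaves the smaller in place.\<close>

lemma cech_sign_swap:
  assumes "finite U" "j \<in> U" "t \<in> U" "j \<noteq> t"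
  shows "cech_sign U j * cech_sign (U - {j}) t
    = - (cech_sign U t * cech_sign (U - {t}) j :: 'a::comm_ring_1)"
proof -
  have less: "cech_sign U j * cech_sign (U - {j}) t
      = - (cech_sign U t * cech_sign (U - {t}) j :: 'a)"
    if "j \<in> U" "j < t" for j t
  proof -
    have "{s \<in> U - {t}. s < j} = {s \<in> U. s < j}" using that by auto
    moreover have "{s \<in> U. s < t} = insert j {s \<in> U - {j}. s < t}" using that by auto
    ultimately show ?thesis using assms(1) by (simp add: cech_sign_def)
  qed
  show ?thesis
  proof (cases "j < t")
    case False
    then have "t < j" using assms(4) by simp
    from less[OF assms(3) this] show ?thesis by simp
  qed (use less[OF assms(2)] in simp)
qed

text \<open>Ordered pairs are cancelled against their transposes directly. That the sum equals its
  own negative would not suffice in characteristic 2.\<close>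

lemma sum_antisymmetric:
  fixes f :: "'b \<Rightarrow> 'b \<Rightarrow> 'a::ab_group_add"
  assumes "finite U" "\<And>j t. j \<in> U \<Longrightarrow> t \<in> U \<Longrightarrow> j \<noteq> t \<Longrightarrow> f j t = - f t j"
  shows "(\<Sum>j\<in>U. \<Sum>t\<in>U - {j}. f j t) = 0"
  using assms
proof (induction U)
  case (insert u U)
  have "(\<Sum>t\<in>insert u U - {j}. f j t) = f j u + (\<Sum>t\<in>U - {j}. f j t)" if "j \<in> U" for j
  proof -
    have "insert u U - {j} = insert u (U - {j})" using that insert.hyps by auto
    then show ?thesis using insert.hyps by simp
  qed
  then have "(\<Sum>j\<in>insert u U. \<Sum>t\<in>insert u U - {j}. f j t)
      = (\<Sum>t\<in>U. f u t) + (\<Sum>j\<in>U. f j u + (\<Sum>t\<in>U - {j}. f j t))"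
    using insert.hyps by simp
  also have "\<dots> = (\<Sum>t\<in>U. f u t + f t u) + (\<Sum>j\<in>U. \<Sum>t\<in>U - {j}. f j t)"
    by (simp add: sum.distrib add.assoc)
  also have "(\<Sum>t\<in>U. f u t + f t u) = 0"
  proof (rule sum.neutral, rule ballI)
    fix t assume "t \<in> U"
    then have "f u t = - f t u" using insert.hyps by (intro insert.prems) auto
    then show "f u t + f t u = 0" by simp
  qed
  also have "(\<Sum>j\<in>U. \<Sum>t\<in>U - {j}. f j t) = 0"
    by (rule insert.IH) (rule insert.prems, auto)
  finally show ?case by simp
qed simp

lemma cech_d_add: "cech_d x k (\<lambda>S. a S + b S) T = cech_d x k a T + cech_d x k b T"
  unfolding cech_d_def by (simp add: algebra_simps sum.distrib)

lemma cech_d_diff: "cech_d x k (\<lambda>S. a S - b S) T = cech_d x k a T - cech_d x k b T"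
  unfolding cech_d_def by (simp add: algebra_simps sum_subtractf)

lemma cech_d_smult: "cech_d x k (\<lambda>S. r * a S) T = r * cech_d x k a T"
  unfolding cech_d_def sum_distrib_left by (rule sum.cong) (simp_all add: mult_ac)

lemma cech_d_zero: "cech_d x k (\<lambda>S. 0) T = 0"
  unfolding cech_d_def by simp

lemma cech_d_mem:
  assumes "is_ideal J" "T \<in> faces n (Suc i)" "\<And>S. S \<in> faces n i \<Longrightarrow> a S \<in> J"
  shows "cech_d x k a T \<in> J"
  unfolding cech_d_def
  by (intro ideal_sum_mem ideal_mult_right[OF assms(1)] ideal_mult[OF assms(1)] assms(1,3)
      faces_remove[OF assms(2)])

text \<open>The numerator \<open>x_S^N a S\<close> over \<open>x_S^(k+N)\<close> is the same
  fraction as \<open>a S\<close> over \<open>x_S^k\<close>; the differential respects this because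
  \<open>prodx x T\<close> is \<open>x j\<close> times the product over
  \<open>T - {j}\<close>.\<close>

lemma cech_d_rescale:
  assumes "finite T"
  shows "cech_d x (k + N) (\<lambda>S. prodx x S ^ N * a S) T = prodx x T ^ N * cech_d x k a T"
  unfolding cech_d_def sum_distrib_left
proof (rule sum.cong)
  fix j assume "j \<in> T"
  then have "prodx x T ^ N = x j ^ N * prodx x (T - {j}) ^ N"
    using prodx_remove[OF assms, of j x] by (simp add: power_mult_distrib)
  then show "cech_sign T j * (prodx x (T - {j}) ^ N * a (T - {j})) * x j ^ (k + N)
      = prodx x T ^ N * (cech_sign T j * a (T - {j}) * x j ^ k)"
    by (simp add: power_add mult_ac)
qed simp

lemma cech_d_cech_d:
  assumes "finite U"
  shows "cech_d x k (cech_d x k a) U = 0"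
proof -
  let ?f = "\<lambda>j t. cech_sign U j * cech_sign (U - {j}) t * (a (U - {j} - {t}) * x j ^ k * x t ^ k)"
  have "cech_d x k (cech_d x k a) U = (\<Sum>j\<in>U. \<Sum>t\<in>U - {j}. ?f j t)"
    unfolding cech_d_def sum_distrib_left sum_distrib_right
    by (intro sum.cong) (simp_all add: mult_ac)
  also have "\<dots> = 0"
  proof (rule sum_antisymmetric[OF assms])
    fix j t assume jt: "j \<in> U" "t \<in> U" "j \<noteq> t"
    have "U - {j} - {t} = U - {t} - {j}" by auto
    then show "?f j t = - ?f t j"
      by (simp add: cech_sign_swap[OF assms jt] mult_ac)
  qed
  finally show ?thesis .
qed

lemma cech_d_power_char:
  fixes x :: "nat \<Rightarrow> 'a::comm_ring_1"
  assumes "prime CHAR('a)"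
  shows "cech_d x k a T ^ CHAR('a) = cech_d x (k * CHAR('a)) (\<lambda>S. a S ^ CHAR('a)) T"
proof -
  have "cech_sign T j ^ CHAR('a) = (cech_sign T j :: 'a)" for j
  proof -
    have "cech_sign T j = (1 :: 'a) \<or> cech_sign T j = (- 1 :: 'a)"
      unfolding cech_sign_def using neg_one_even_power neg_one_odd_power by blast
    then show ?thesis using minus_power_prime_CHAR[OF refl assms, of 1] by auto
  qed
  then show ?thesis
    unfolding cech_d_def freshmans_dream_sum[OF assms refl]
    by (simp add: power_mult_distrib power_mult)
qed

text \<open>A cochain \<open>a\<close> of degree \<open>i\<close> at level \<open>k\<close> stands for the family \<open>a S / x_S^k\<close>, now with
  values in the localisations of \<open>R/J\<close>; clearing denominators makes the cocycle condition strict.\<close>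

definition strict_cocycle ::
    "(nat \<Rightarrow> 'a::comm_ring_1) \<Rightarrow> nat \<Rightarrow> 'a set \<Rightarrow> nat \<Rightarrow> nat \<Rightarrow> (nat set \<Rightarrow> 'a) \<Rightarrow> bool" where
  "strict_cocycle x n J i k a \<longleftrightarrow> (\<forall>T\<in>faces n (Suc i). cech_d x k a T \<in> J)"

text \<open>A large \<open>N\<close> makes room for a primitive with any denominator. In degree 0
  the differential is an empty sum, so the condition says that the class vanishes.\<close>

definition coboundary_mod ::
    "(nat \<Rightarrow> 'a::comm_ring_1) \<Rightarrow> nat \<Rightarrow> 'a set \<Rightarrow> nat \<Rightarrow> nat \<Rightarrow> (nat set \<Rightarrow> 'a) \<Rightarrow> bool" where
  "coboundary_mod x n J i k a \<longleftrightarrow>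
    (\<exists>b N. \<forall>S\<in>faces n i. prodx x S ^ N * a S - cech_d x (k + N) b S \<in> J)"

lemma coboundary_modI:
  "(\<And>S. S \<in> faces n i \<Longrightarrow> prodx x S ^ N * a S - cech_d x (k + N) b S \<in> J) \<Longrightarrow>
    coboundary_mod x n J i k a"
  unfolding coboundary_mod_def by blast

lemma coboundary_mod_degree0:
  "coboundary_mod x n J 0 k a \<longleftrightarrow> a {} \<in> J"
proof -
  have "faces n 0 = {{}}" unfolding faces_def by (auto dest: finite_subset)
  then show ?thesis unfolding coboundary_mod_def by (simp add: cech_d_def prodx_def)
qed

lemma coboundary_mod_rescale:
  assumes "is_ideal J"
  shows "coboundary_mod x n J i (k + M) (\<lambda>S. prodx x S ^ M * a S) \<longleftrightarrow> coboundary_mod x n J i k a"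
proof
  assume "coboundary_mod x n J i (k + M) (\<lambda>S. prodx x S ^ M * a S)"
  then obtain b N where
    "prodx x S ^ N * (prodx x S ^ M * a S) - cech_d x (k + M + N) b S \<in> J" if "S \<in> faces n i" for S
    unfolding coboundary_mod_def by blast
  then show "coboundary_mod x n J i k a"
    by (intro coboundary_modI[where b = b and N = "M + N"]) (simp add: power_add add.assoc mult_ac)
next
  assume "coboundary_mod x n J i k a"
  then obtain b N where b:
    "prodx x S ^ N * a S - cech_d x (k + N) b S \<in> J" if "S \<in> faces n i" for S
    unfolding coboundary_mod_def by blast
  show "coboundary_mod x n J i (k + M) (\<lambda>S. prodx x S ^ M * a S)"
  proof (rule coboundary_modI[where b = "\<lambda>S. prodx x S ^ M * b S" and N = N])
    fix S assume S: "S \<in> faces n i"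
    have "prodx x S ^ M * (prodx x S ^ N * a S - cech_d x (k + N) b S) \<in> J"
      using b[OF S] by (rule ideal_mult[OF assms])
    moreover have "k + M + N = k + N + M" by simp
    ultimately show "prodx x S ^ N * (prodx x S ^ M * a S)
        - cech_d x (k + M + N) (\<lambda>S. prodx x S ^ M * b S) S \<in> J"
      by (simp only: cech_d_rescale[OF faces_finite[OF S]]) (simp add: algebra_simps)
  qed
qed

text \<open>A contracting homotopy: up to sign \<open>b S = a (S \<union> {j})\<close>, so that the class of \<open>a\<close> dies in the
  localisation at \<open>x j\<close>.\<close>

lemma cech_homotopy:
  assumes J: "is_ideal J" and "j < n" and a: "strict_cocycle x n J i k a"
  shows "\<exists>b. \<forall>S\<in>faces n i. x j ^ k * a S - cech_d x k b S \<in> J"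
proof (intro exI ballI)
  let ?b = "\<lambda>S. if j \<in> S then 0 else cech_sign S j * a (insert j S)"
  fix S assume S: "S \<in> faces n i"
  note fin = faces_finite[OF S]
  show "x j ^ k * a S - cech_d x k ?b S \<in> J"
  proof (cases "j \<in> S")
    case True
    have "cech_d x k ?b S = cech_sign S j * ?b (S - {j}) * x j ^ k
        + (\<Sum>t\<in>S - {j}. cech_sign S t * ?b (S - {t}) * x t ^ k)"
      unfolding cech_d_def by (rule sum.remove[OF fin True])
    \<comment> \<open>For \<open>t\<close> other than \<open>j\<close> the face
      \<open>S - {t}\<close> still contains \<open>j\<close>, where \<open>?b\<close> is 0.\<close>
    also have "(\<Sum>t\<in>S - {j}. cech_sign S t * ?b (S - {t}) * x t ^ k) = 0"
      using True by (intro sum.neutral) auto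
    also have "cech_sign S j * ?b (S - {j}) * x j ^ k + 0 = x j ^ k * a S"
      using True by (simp add: cech_sign_remove_self insert_absorb cech_sign_sq mult.commute[of _ "x j ^ k"])
    finally show ?thesis using ideal_zero[OF J] by simp
  next
    case False
    let ?U = "insert j S"
    have U: "?U \<in> faces n (Suc i)" by (rule faces_insert[OF S \<open>j < n\<close> False])
    \<comment> \<open>In the cocycle condition on \<open>?U\<close> the summand of \<open>j\<close>
      is \<open>x j ^ k * a S\<close> up to sign, and the others make up the differential of
      \<open>?b\<close> up to sign.\<close>
    have "cech_d x k a ?U = cech_sign ?U j * a S * x j ^ k
        + (\<Sum>t\<in>S. cech_sign ?U t * a (?U - {t}) * x t ^ k)"
      unfolding cech_d_def using fin False by simp
    then have "cech_sign ?U j * cech_d x k a ?U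
        = x j ^ k * a S + (\<Sum>t\<in>S. cech_sign ?U j * (cech_sign ?U t * a (?U - {t}) * x t ^ k))"
      by (simp add: distrib_left cech_sign_sq sum_distrib_left mult.assoc mult.commute[of "a S"])
    also have "(\<Sum>t\<in>S. cech_sign ?U j * (cech_sign ?U t * a (?U - {t}) * x t ^ k)) = - cech_d x k ?b S"
      unfolding cech_d_def sum_negf[symmetric]
    proof (rule sum.cong[OF refl])
      fix t assume t: "t \<in> S"
      then have jt: "j \<noteq> t" using False by auto
      let ?a = "a (?U - {t}) * x t ^ k"
      have U': "?U - {j} = S" "insert j (S - {t}) = ?U - {t}" "?U - {t} - {j} = S - {t}"
        using False jt by auto
      have s1: "cech_sign (S - {t}) j = (cech_sign (?U - {t}) j :: 'a)"
        using cech_sign_remove_self[of "?U - {t}" j] U'(3) by simp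
      have "cech_sign ?U j * cech_sign S t = (- (cech_sign ?U t * cech_sign (S - {t}) j) :: 'a)"
        using cech_sign_swap[of ?U j t] fin t jt s1 U' by simp
      then have "cech_sign ?U j * (cech_sign ?U j * cech_sign S t * (cech_sign (S - {t}) j * ?a))
        = cech_sign ?U j * (- (cech_sign ?U t * cech_sign (S - {t}) j) * (cech_sign (S - {t}) j * ?a))"
        by (simp only:)
      then show "cech_sign ?U j * (cech_sign ?U t * a (?U - {t}) * x t ^ k)
          = - (cech_sign S t * ?b (S - {t}) * x t ^ k)"
        using False U' by (simp add: cech_sign_sq mult.assoc)
    qed
    finally have "x j ^ k * a S - cech_d x k ?b S = cech_sign ?U j * cech_d x k a ?U" by simp
    then show ?thesis
      using a U ideal_mult[OF J] unfolding strict_cocycle_def by metis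
  qed
qed

text \<open>The multipliers \<open>u\<close> for which \<open>u * a\<close> is a coboundary at the
  same level \<open>k\<close> form an ideal \<open>Q\<close>. The homotopy puts a power of every
  \<open>x j\<close> into \<open>Q\<close>, so the radical of \<open>Q\<close> contains the ideal
  they generate.\<close>

lemma cech_torsion:
  fixes x :: "nat \<Rightarrow> 'a::comm_ring_1"
  assumes "prime CHAR('a)" and J: "is_ideal J" and a: "strict_cocycle x n J i k a"
    and y: "y \<in> ideal_gen (x ` {..<n})"
  shows "\<exists>K>0. \<exists>b. \<forall>S\<in>faces n i. y ^ K * a S - cech_d x k b S \<in> J"
proof -
  let ?P = "\<lambda>u b. \<forall>S\<in>faces n i. u * a S - cech_d x k b S \<in> J"
  define Q where "Q = {u. \<exists>b. ?P u b}"
  have Q: "is_ideal Q"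
  proof (rule is_idealI)
    show "0 \<in> Q"
      unfolding Q_def using ideal_zero[OF J] by (auto intro!: exI[of _ "\<lambda>_. 0"] simp: cech_d_zero)
  next
    fix u v assume "u \<in> Q" "v \<in> Q"
    then obtain b c where bc: "?P u b" "?P v c" unfolding Q_def by blast
    have "?P (u + v) (\<lambda>S. b S + c S)"
    proof
      fix S assume S: "S \<in> faces n i"
      show "(u + v) * a S - cech_d x k (\<lambda>S. b S + c S) S \<in> J"
        using ideal_add[OF J bc(1)[rule_format, OF S] bc(2)[rule_format, OF S]]
        by (simp add: cech_d_add algebra_simps)
    qed
    then show "u + v \<in> Q" unfolding Q_def by blast
  next
    fix r u assume "u \<in> Q"
    then obtain b where b: "?P u b" unfolding Q_def by blast
    have "?P (r * u) (\<lambda>S. r * b S)"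
    proof
      fix S assume "S \<in> faces n i"
      from ideal_mult[OF J b[rule_format, OF this], of r]
      show "r * u * a S - cech_d x k (\<lambda>S. r * b S) S \<in> J"
        by (simp add: cech_d_smult algebra_simps)
    qed
    then show "r * u \<in> Q" unfolding Q_def by blast
  qed
  have "x ` {..<n} \<subseteq> radical Q"
    using cech_homotopy[OF J _ a] unfolding radical_def Q_def by blast
  then have "ideal_gen (x ` {..<n}) \<subseteq> radical Q"
    by (rule ideal_gen_least[OF is_ideal_radical[OF assms(1) Q]])
  then obtain K where "y ^ K \<in> Q" using y unfolding radical_def by blast
  \<comment> \<open>The extra factor makes the exponent positive, as
    \<open>weakly_regular_power_hd\<close> asks.\<close>
  then have "y ^ Suc K \<in> Q" using ideal_mult[OF Q] by simp
  then show ?thesis unfolding Q_def by blast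
qed

text \<open>The connecting homomorphism of \<open>0 \<rightarrow> R/J \<rightarrow> R/J \<rightarrow> R/(J + y) \<rightarrow> 0\<close> sends the class of \<open>b\<close>
  to the class of \<open>a\<close>, where \<open>y a = d b\<close> modulo \<open>J\<close>.\<close>

lemma coboundary_mod_connecting:
  assumes J: "is_ideal J" and nz: "nonzerodivisor_mod J y"
    and ab: "\<And>S. S \<in> faces n (Suc i) \<Longrightarrow> y * a S - cech_d x k b S \<in> J"
    and b: "coboundary_mod x n (ideal_adjoin J y) i k b"
  shows "coboundary_mod x n J (Suc i) k a"
proof -
  obtain c N where "prodx x S ^ N * b S - cech_d x (k + N) c S \<in> ideal_adjoin J y"
    if "S \<in> faces n i" for S
    using b unfolding coboundary_mod_def by blast
  then have "\<exists>r. S \<in> faces n i \<longrightarrow> prodx x S ^ N * b S - cech_d x (k + N) c S - r * y \<in> J" for S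
    using ideal_adjoin_iff by blast
  \<comment> \<open>A primitive \<open>c\<close> of \<open>b\<close> modulo \<open>J + (y)\<close>
    leaves an error \<open>g * y\<close> modulo \<open>J\<close>. Applying the differential and
    cancelling \<open>y\<close> turns \<open>g\<close> into a primitive of \<open>a\<close>.\<close>
  then obtain g where g:
    "\<And>S. S \<in> faces n i \<Longrightarrow> prodx x S ^ N * b S - cech_d x (k + N) c S - g S * y \<in> J"
    by metis
  show ?thesis
  proof (rule coboundary_modI[where b = g and N = N])
    fix T assume T: "T \<in> faces n (Suc i)"
    note fin = faces_finite[OF T]
    let ?P = "prodx x T ^ N" and ?d = "cech_d x (k + N)"
    have "?d (\<lambda>S. prodx x S ^ N * b S - ?d c S - g S * y) T \<in> J"
      by (rule cech_d_mem[OF J T g])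
    also have "?d (\<lambda>S. prodx x S ^ N * b S - ?d c S - g S * y) T
        = ?P * cech_d x k b T - y * ?d g T"
      by (simp add: cech_d_diff cech_d_rescale[OF fin] cech_d_cech_d[OF fin]
          mult.commute[of _ y] cech_d_smult)
    finally have "?P * (y * a T - cech_d x k b T) + (?P * cech_d x k b T - y * ?d g T) \<in> J"
      using ideal_add[OF J ideal_mult[OF J ab[OF T]]] by blast
    then have "y * (?P * a T - ?d g T) \<in> J" by (simp add: algebra_simps)
    then show "?P * a T - ?d g T \<in> J" using nz unfolding nonzerodivisor_mod_def by blast
  qed
qed

lemma strict_cocycle_connecting:
  assumes J: "is_ideal J"
    and ab: "\<And>S. S \<in> faces n (Suc i) \<Longrightarrow> y * a S - cech_d x k b S \<in> J"
  shows "strict_cocycle x n (ideal_adjoin J y) i k b"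
  unfolding strict_cocycle_def
proof
  fix T assume "T \<in> faces n (Suc i)"
  from ideal_minus[OF J ab[OF this]] show "cech_d x k b T \<in> ideal_adjoin J y"
    unfolding ideal_adjoin_iff by (auto intro!: exI[of _ "a T"] simp: mult.commute)
qed

text \<open>A power \<open>y ^ K\<close> of the first element kills the class, which thus comes by a
  connecting homomorphism from one degree lower over \<open>R/(J + y ^ K)\<close>. The rest of the
  sequence is weakly regular there, so induction applies. In degree 0 the nonzerodivisor
  \<open>y ^ K\<close> is cancelled directly.\<close>

lemma cech_vanishing:
  fixes x :: "nat \<Rightarrow> 'a::comm_ring_1"
  assumes "prime CHAR('a)" and "set ys \<subseteq> ideal_gen (x ` {..<n})"
    and "is_ideal J" "weakly_regular J ys" "i < length ys" "strict_cocycle x n J i k a"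
  shows "coboundary_mod x n J i k a"
  using assms(2-)
proof (induction i arbitrary: J ys a)
  case 0
  then obtain y ys' where ys: "ys = y # ys'" by (cases ys) auto
  obtain K b where "K > 0" and b: "\<forall>S\<in>faces n 0. y ^ K * a S - cech_d x k b S \<in> J"
    using cech_torsion[OF assms(1) 0(2) 0(5), of y] 0(1) ys by auto
  have "nonzerodivisor_mod J (y ^ K)" using 0(3) ys by (auto intro: nonzerodivisor_mod_power)
  moreover have "y ^ K * a {} \<in> J"
    using b by (auto simp: faces_def cech_d_def)
  ultimately show ?case unfolding coboundary_mod_degree0 nonzerodivisor_mod_def by blast
next
  case (Suc i)
  note J = Suc.prems(2)
  obtain y ys' where ys: "ys = y # ys'" using Suc.prems(4) by (cases ys) auto
  obtain K b where "K > 0" and b: "\<forall>S\<in>faces n (Suc i). y ^ K * a S - cech_d x k b S \<in> J"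
    using cech_torsion[OF assms(1) J Suc.prems(5), of y] Suc.prems(1) ys by auto
  have "weakly_regular J (y ^ K # ys')"
    using weakly_regular_power_hd[OF J _ \<open>K > 0\<close>] Suc.prems(3) ys by blast
  then have nz: "nonzerodivisor_mod J (y ^ K)" and ys': "weakly_regular (ideal_adjoin J (y ^ K)) ys'"
    by auto
  have "strict_cocycle x n (ideal_adjoin J (y ^ K)) i k b"
    using strict_cocycle_connecting[OF J] b by blast
  then have "coboundary_mod x n (ideal_adjoin J (y ^ K)) i k b"
    using Suc.IH[OF _ is_ideal_adjoin[OF J] ys'] Suc.prems(1,4) ys by simp
  then show ?case using coboundary_mod_connecting[OF J nz] b by blast
qed

text \<open>In degree \<open>length ys\<close> the class of \<open>a\<close> is the image of an element \<open>r\<close> of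
  \<open>H^0(R/(J + (zs))) = R/(J + (zs))\<close>, with \<open>zs\<close> powers of \<open>ys\<close>, under injective iterated connecting
  homomorphisms. These commute with the Frobenius maps, so that \<open>r ^ p\<close> dies if \<open>a ^ p\<close> does.\<close>

lemma cech_frobenius_descent:
  fixes x :: "nat \<Rightarrow> 'a::comm_ring_1"
  defines "p \<equiv> CHAR('a)"
  assumes p: "prime CHAR('a)" and "set ys \<subseteq> ideal_gen (x ` {..<n})"
    and "is_ideal J" "is_ideal J'" "\<And>r. r \<in> J \<Longrightarrow> r ^ p \<in> J'"
    and "weakly_regular J ys" "weakly_regular J' (map (\<lambda>y. y ^ p) ys)"
    and "\<And>zs r. list_all2 (\<lambda>z y. \<exists>K>0. z = y ^ K) zs ys \<Longrightarrow>
      r ^ p \<in> foldl ideal_adjoin J' (map (\<lambda>z. z ^ p) zs) \<Longrightarrow> r \<in> foldl ideal_adjoin J zs"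
    and "strict_cocycle x n J (length ys) k a"
    and "coboundary_mod x n J' (length ys) (k * p) (\<lambda>S. a S ^ p)"
  shows "coboundary_mod x n J (length ys) k a"
  using assms(3-)
\<comment> \<open>Each round adjoins \<open>z = y ^ K\<close> to \<open>J\<close> and
  \<open>z ^ p\<close> to \<open>J'\<close>. As \<open>K\<close> depends on the cocycle, the
  reflection hypothesis ranges over all lists of positive powers.\<close>
proof (induction ys arbitrary: J J' a)
  case Nil
  then show ?case by (simp add: coboundary_mod_degree0)
next
  case (Cons y ys)
  have p0: "p > 0" using p unfolding p_def by (rule prime_gt_0_nat)
  note J = Cons.prems(2) and J' = Cons.prems(3) and JJ' = Cons.prems(4)
  let ?i = "length ys"
  obtain K b where K: "K > 0" and b: "\<And>S. S \<in> faces n (Suc ?i) \<Longrightarrow> y ^ K * a S - cech_d x k b S \<in> J"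
    using cech_torsion[OF p J, of x n "Suc ?i" k a y] Cons.prems(1,8) by auto
  define z z' where "z = y ^ K" and "z' = z ^ p"
  have "weakly_regular J (z # ys)"
    unfolding z_def by (rule weakly_regular_power_hd[OF J Cons.prems(5) K])
  then have nz: "nonzerodivisor_mod J z" and reg: "weakly_regular (ideal_adjoin J z) ys"
    by auto
  have z': "z' = (y ^ p) ^ K" unfolding z'_def z_def by (simp add: mult.commute flip: power_mult)
  have reg2: "weakly_regular J' (z' # map (\<lambda>y. y ^ p) ys)"
    unfolding z' using Cons.prems(6) by (intro weakly_regular_power_hd[OF J' _ K]) simp
  then have nz': "nonzerodivisor_mod J' z'"
    and reg': "weakly_regular (ideal_adjoin J' z') (map (\<lambda>y. y ^ p) ys)"
    by auto
  have frob: "r ^ p \<in> ideal_adjoin J' z'" if r: "r \<in> ideal_adjoin J z" for r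
  proof -
    obtain s where "r - s * z \<in> J" using r ideal_adjoin_iff by blast
    then have "(r - s * z) ^ p + s ^ p * z' \<in> ideal_adjoin J' z'" by (intro ideal_adjoinI JJ')
    then show ?thesis
      using freshmans_dream[OF p p_def[THEN meta_eq_to_obj_eq], of "r - s * z" "s * z"]
      by (simp add: z'_def power_mult_distrib)
  qed
  have b': "z' * a S ^ p - cech_d x (k * p) (\<lambda>S. b S ^ p) S \<in> J'" if S: "S \<in> faces n (Suc ?i)" for S
  proof -
    have "(z * a S - cech_d x k b S) ^ p \<in> J'" unfolding z_def by (intro JJ' b S)
    moreover have "(z * a S) ^ p = (z * a S - cech_d x k b S) ^ p + cech_d x k b S ^ p"
      using freshmans_dream[OF p p_def[THEN meta_eq_to_obj_eq], of "z * a S - cech_d x k b S" "cech_d x k b S"]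
      by simp
    moreover have "cech_d x k b S ^ p = cech_d x (k * p) (\<lambda>S. b S ^ p) S"
      using cech_d_power_char[OF p] unfolding p_def .
    ultimately show ?thesis by (simp add: power_mult_distrib z'_def)
  qed
  obtain c N where c: "\<And>S. S \<in> faces n (Suc ?i) \<Longrightarrow>
      prodx x S ^ N * a S ^ p - cech_d x (k * p + N) c S \<in> J'"
    using Cons.prems(9) unfolding coboundary_mod_def by auto
  \<comment> \<open>Modulo \<open>J'\<close> and up to denominators, \<open>b ^ p\<close> and
    \<open>z' * c\<close> are primitives of the same cochain \<open>z' * a ^ p\<close>, so their
    difference \<open>h\<close> is a cocycle. Its degree is below the length of the sequence over
    \<open>J'\<close>, so it is a coboundary; modulo \<open>z'\<close> the same then holds for
    \<open>b ^ p\<close>.\<close>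
  define h where "h S = prodx x S ^ N * b S ^ p - z' * c S" for S
  have "strict_cocycle x n J' ?i (k * p + N) h"
    unfolding strict_cocycle_def
  proof
    fix T assume T: "T \<in> faces n (Suc ?i)"
    note fin = faces_finite[OF T]
    have "z' * (prodx x T ^ N * a T ^ p - cech_d x (k * p + N) c T)
        - prodx x T ^ N * (z' * a T ^ p - cech_d x (k * p) (\<lambda>S. b S ^ p) T) \<in> J'"
      by (intro ideal_diff J' ideal_mult c b' T)
    also have "z' * (prodx x T ^ N * a T ^ p - cech_d x (k * p + N) c T)
        - prodx x T ^ N * (z' * a T ^ p - cech_d x (k * p) (\<lambda>S. b S ^ p) T)
      = cech_d x (k * p + N) h T"
      unfolding h_def cech_d_diff cech_d_rescale[OF fin] cech_d_smult by (simp add: algebra_simps)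
    finally show "cech_d x (k * p + N) h T \<in> J'" .
  qed
  moreover have "u ^ p \<in> ideal_gen (x ` {..<n})" if "u \<in> ideal_gen (x ` {..<n})" for u
    using ideal_pow_mono[OF is_ideal_gen, of u 1 _ p] that p0 by simp
  ultimately have "coboundary_mod x n J' ?i (k * p + N) h"
    using Cons.prems(1,6)
    by (intro cech_vanishing[OF p _ J', where ys = "map (\<lambda>y. y ^ p) (y # ys)"])
      auto
  then obtain e M where e: "\<And>S. S \<in> faces n ?i \<Longrightarrow>
      prodx x S ^ M * h S - cech_d x (k * p + N + M) e S \<in> J'"
    unfolding coboundary_mod_def by blast
  have "coboundary_mod x n (ideal_adjoin J' z') ?i (k * p) (\<lambda>S. b S ^ p)"
  proof (rule coboundary_modI[where b = e and N = "N + M"])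
    fix S assume "S \<in> faces n ?i"
    from ideal_adjoinI[OF e[OF this], of "prodx x S ^ M * c S" z']
    show "prodx x S ^ (N + M) * b S ^ p - cech_d x (k * p + (N + M)) e S \<in> ideal_adjoin J' z'"
      by (simp add: h_def algebra_simps power_add)
  qed
  moreover have "strict_cocycle x n (ideal_adjoin J z) ?i k b"
    using strict_cocycle_connecting[OF J] b unfolding z_def by blast
  moreover have "r \<in> foldl ideal_adjoin (ideal_adjoin J z) zs"
    if zs: "list_all2 (\<lambda>z y. \<exists>K>0. z = y ^ K) zs ys"
      and r: "r ^ p \<in> foldl ideal_adjoin (ideal_adjoin J' z') (map (\<lambda>z. z ^ p) zs)" for zs r
    using Cons.prems(7)[of "z # zs" r] zs r K by (auto simp: z'_def z_def)
  ultimately have "coboundary_mod x n (ideal_adjoin J z) ?i k b"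
    using Cons.prems(1) frob reg reg'
    by (intro Cons.IH[OF _ is_ideal_adjoin[OF J] is_ideal_adjoin[OF J']]) auto
  then show ?case
    using coboundary_mod_connecting[OF J nz, of n ?i a x k b] b unfolding z_def by simp
qed

section \<open>Clearing denominators\<close>

lemma loc_eq_zero_iff: "loc_eq x S (u, k) (0, 0) \<longleftrightarrow> (\<exists>N. prodx x S ^ N * u = 0)"
  unfolding loc_eq_def by simp

lemma uniform_exponent:
  fixes g u :: "'b \<Rightarrow> 'a::comm_ring_1"
  assumes "finite A" "\<And>S. S \<in> A \<Longrightarrow> \<exists>N. g S ^ N * u S = 0"
  shows "\<exists>N. \<forall>S\<in>A. g S ^ N * u S = 0"
proof -
  obtain f where f: "\<And>S. S \<in> A \<Longrightarrow> g S ^ f S * u S = 0" using assms(2) by metis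
  have "g S ^ (\<Sum>S\<in>A. f S) * u S = 0" if S: "S \<in> A" for S
  proof -
    have "(\<Sum>S\<in>A. f S) = (\<Sum>S\<in>A - {S}. f S) + f S" using assms(1) S by (simp add: sum.remove)
    then show ?thesis using f[OF S] by (simp add: power_add mult.assoc)
  qed
  then show ?thesis by blast
qed

text \<open>The Cech definition allows the primitive its own denominator and each face its own
  exponent; there are finitely many faces, so one exponent serves all.\<close>

lemma cech_coboundary_iff: "cech_coboundary x n i a k \<longleftrightarrow> coboundary_mod x n {0} i k a"
proof (cases i)
  case 0
  have "faces n 0 = {{}}" unfolding faces_def by (auto dest: finite_subset)
  then show ?thesis
    using 0 unfolding cech_coboundary_def
    by (simp add: coboundary_mod_degree0 loc_eq_zero_iff prodx_def)
next
  case (Suc i')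
  have "cech_coboundary x n i a k \<longleftrightarrow> (\<exists>b l. \<forall>S\<in>faces n i. loc_eq x S (cech_d x l b S, l) (a S, k))"
    unfolding cech_coboundary_def using Suc by simp
  also have "\<dots> \<longleftrightarrow> coboundary_mod x n {0} i k a"
  proof
    assume "\<exists>b l. \<forall>S\<in>faces n i. loc_eq x S (cech_d x l b S, l) (a S, k)"
    then obtain b l where bl: "\<And>S. S \<in> faces n i \<Longrightarrow>
        \<exists>N. prodx x S ^ N * (cech_d x l b S * prodx x S ^ k - a S * prodx x S ^ l) = 0"
      unfolding loc_eq_def by auto
    let ?u = "\<lambda>S. cech_d x l b S * prodx x S ^ k - a S * prodx x S ^ l"
    from uniform_exponent[of "faces n i" "prodx x" ?u, OF finite_faces bl] obtain N where N: "\<And>S. S \<in> faces n i \<Longrightarrow>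
        prodx x S ^ N * (cech_d x l b S * prodx x S ^ k - a S * prodx x S ^ l) = 0"
      by blast
    \<comment> \<open>The two exponents bring \<open>a\<close> and \<open>b\<close> to the common
      level \<open>k + l + N\<close>.\<close>
    show "coboundary_mod x n {0} i k a"
    proof (rule coboundary_modI[where N = "N + l" and b = "\<lambda>S. prodx x S ^ (N + k) * b S"])
      fix S assume S: "S \<in> faces n i"
      have "k + (N + l) = l + (N + k)" by simp
      then have "cech_d x (k + (N + l)) (\<lambda>S. prodx x S ^ (N + k) * b S) S
          = prodx x S ^ (N + k) * cech_d x l b S"
        by (simp only: cech_d_rescale[OF faces_finite[OF S]])
      then show "prodx x S ^ (N + l) * a S
          - cech_d x (k + (N + l)) (\<lambda>S. prodx x S ^ (N + k) * b S) S \<in> {0}"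
        using N[OF S] by (simp add: power_add algebra_simps)
    qed
  next
    assume "coboundary_mod x n {0} i k a"
    then obtain b N where b: "\<And>S. S \<in> faces n i \<Longrightarrow> prodx x S ^ N * a S = cech_d x (k + N) b S"
      unfolding coboundary_mod_def by auto
    have "loc_eq x S (cech_d x (k + N) b S, k + N) (a S, k)" if "S \<in> faces n i" for S
      unfolding loc_eq_def using b[OF that, symmetric]
      by (auto intro!: exI[of _ 0] simp: power_add mult_ac)
    then show "\<exists>b l. \<forall>S\<in>faces n i. loc_eq x S (cech_d x l b S, l) (a S, k)" by blast
  qed
  finally show ?thesis .
qed

text \<open>A cocycle satisfies its equations only after multiplication by powers of
  \<open>prodx x T\<close>. Raising the level by a common \<open>N\<close> makes them strict without
  changing the class, and Frobenius turns the shift \<open>N\<close> into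
  \<open>N * p\<close>.\<close>

lemma frob_injective_cechI:
  assumes "\<And>a k. strict_cocycle x n {0} i k a \<Longrightarrow>
    coboundary_mod x n {0} i (k * p) (\<lambda>S. a S ^ p) \<Longrightarrow> coboundary_mod x n {0} i k a"
  shows "frob_injective_cech p x n i"
  unfolding frob_injective_cech_def cech_coboundary_iff
proof (intro allI impI, elim conjE)
  fix a k
  assume "cech_cocycle x n i a k" and F: "coboundary_mod x n {0} i (k * p) (\<lambda>S. a S ^ p)"
  then have "\<And>T. T \<in> faces n (Suc i) \<Longrightarrow> \<exists>N. prodx x T ^ N * cech_d x k a T = 0"
    unfolding cech_cocycle_def loc_eq_zero_iff by blast
  from uniform_exponent[of "faces n (Suc i)" "prodx x" "cech_d x k a", OF finite_faces this]
  obtain N where N: "\<And>T. T \<in> faces n (Suc i) \<Longrightarrow> prodx x T ^ N * cech_d x k a T = 0"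
    by blast
  let ?a = "\<lambda>S. prodx x S ^ N * a S"
  have "strict_cocycle x n {0} i (k + N) ?a"
    unfolding strict_cocycle_def using N by (simp add: cech_d_rescale faces_finite)
  moreover have "coboundary_mod x n {0} i ((k + N) * p) (\<lambda>S. ?a S ^ p)"
    using coboundary_mod_rescale[OF is_ideal_zero, of x n i "k * p" "N * p" "\<lambda>S. a S ^ p"] F
    by (simp add: power_mult_distrib distrib_right power_mult)
  ultimately have "coboundary_mod x n {0} i (k + N) ?a" by (rule assms)
  then show "coboundary_mod x n {0} i k a"
    by (simp add: coboundary_mod_rescale[OF is_ideal_zero])
qed

section \<open>Noetherian local rings\<close>

text \<open>Inclusion is reversed, so minimal elements are the maximal members of a family and
  induction may assume the claim for all larger ideals.\<close>

lemma noetherian_wf: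
  assumes "noetherian_ring TYPE('a::comm_ring_1)"
  shows "wf {(K, I :: 'a set). is_ideal I \<and> is_ideal K \<and> I \<subset> K}"
  unfolding wf_iff_no_infinite_down_chain
proof
  assume "\<exists>f. \<forall>i. (f (Suc i), f i) \<in> {(K, I :: 'a set). is_ideal I \<and> is_ideal K \<and> I \<subset> K}"
  then obtain f :: "nat \<Rightarrow> 'a set"
    where "\<forall>i. (f (Suc i), f i) \<in> {(K, I). is_ideal I \<and> is_ideal K \<and> I \<subset> K}" ..
  then have f: "is_ideal (f i)" "f i \<subset> f (Suc i)" for i by simp_all
  have mono: "f i \<subseteq> f j" if "i \<le> j" for i j
    using lift_Suc_mono_le[of f] f(2) that by blast
  have "is_ideal (\<Union>i. f i)"
  proof (rule is_idealI)
    show "0 \<in> (\<Union>i. f i)" using ideal_zero[OF f(1)] by blast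
  next
    fix a b assume "a \<in> (\<Union>i. f i)" "b \<in> (\<Union>i. f i)"
    then obtain i j where "a \<in> f i" "b \<in> f j" by blast
    then have "a + b \<in> f (max i j)"
      using mono[of i "max i j"] mono[of j "max i j"] by (intro ideal_add[OF f(1)]) auto
    then show "a + b \<in> (\<Union>i. f i)" by blast
  next
    fix r a assume "a \<in> (\<Union>i. f i)"
    then show "r * a \<in> (\<Union>i. f i)" using ideal_mult[OF f(1)] by blast
  qed
  from assms[unfolded noetherian_ring_def, THEN spec, THEN mp, OF this]
  obtain F where F: "finite F" "(\<Union>i. f i) = ideal_gen F" by (elim exE conjE)
  have "F \<subseteq> (\<Union>i. f i)" unfolding F(2) by (rule ideal_gen_superset)
  have "\<exists>n. G \<subseteq> f n" if "finite G" "G \<subseteq> (\<Union>i. f i)" for G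
    using that
  proof (induction G)
    case (insert g G)
    then obtain n k where "G \<subseteq> f n" "g \<in> f k" by auto
    then have "insert g G \<subseteq> f (max n k)" using mono[of n "max n k"] mono[of k "max n k"] by auto
    then show ?case by blast
  qed simp
  then obtain n where "F \<subseteq> f n" using F(1) \<open>F \<subseteq> (\<Union>i. f i)\<close> by blast
  then have "(\<Union>i. f i) \<subseteq> f n" using ideal_gen_least[OF f(1)] F(2) by simp
  then show False using f(2)[of n] by blast
qed

text \<open>An ideal maximal among those containing \<open>J\<close> and missing \<open>T\<close> is
  prime: two elements outside it yield members of \<open>T\<close> whose product would lie in
  it.\<close>

lemma exists_prime_ideal_disjoint:
  assumes noeth: "noetherian_ring TYPE('a::comm_ring_1)" and J: "is_ideal (J :: 'a set)"
    and T: "1 \<in> T" "\<And>s t. s \<in> T \<Longrightarrow> t \<in> T \<Longrightarrow> s * t \<in> T" and "J \<inter> T = {}"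
  obtains Q where "prime_ideal Q" "J \<subseteq> Q" "Q \<inter> T = {}"
proof -
  let ?C = "{Q. is_ideal Q \<and> J \<subseteq> Q \<and> Q \<inter> T = {}}"
  have "J \<in> ?C" using J assms(5) by blast
  then obtain Q where Q: "Q \<in> ?C"
    and max: "\<And>K. (K, Q) \<in> {(K, I :: 'a set). is_ideal I \<and> is_ideal K \<and> I \<subset> K} \<Longrightarrow> K \<notin> ?C"
    by (rule wfE_min[OF noetherian_wf[OF noeth]]) blast
  have id: "is_ideal Q" using Q by blast
  have meet: "\<exists>q r. q \<in> Q \<and> q + r * a \<in> T" if "a \<notin> Q" for a
  proof -
    have "Q \<subset> ideal_adjoin Q a"
      using ideal_adjoin_superset ideal_adjoin_self[OF id] that by blast
    then have "ideal_adjoin Q a \<notin> ?C" using max is_ideal_adjoin[OF id] id by blast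
    then have "ideal_adjoin Q a \<inter> T \<noteq> {}"
      using Q is_ideal_adjoin[OF id] ideal_adjoin_superset[of Q a] by blast
    then show ?thesis unfolding ideal_adjoin_def by blast
  qed
  have "a \<in> Q \<or> b \<in> Q" if ab: "a * b \<in> Q" for a b
  proof (rule ccontr)
    assume "\<not> (a \<in> Q \<or> b \<in> Q)"
    then obtain q r q' r' where *: "q \<in> Q" "q + r * a \<in> T" "q' \<in> Q" "q' + r' * b \<in> T"
      using meet by metis
    have "(q + r * a) * (q' + r' * b) = q * (q' + r' * b) + (r * a * q' + r * r' * (a * b))"
      by (simp add: algebra_simps)
    then have "(q + r * a) * (q' + r' * b) \<in> Q"
      by (simp only: ideal_add[OF id ideal_mult_right[OF id *(1)]
            ideal_add[OF id ideal_mult[OF id *(3)] ideal_mult[OF id ab]]])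
    then show False using T(2)[OF *(2,4)] Q by blast
  qed
  then have "prime_ideal Q" unfolding prime_ideal_def using id Q T(1) by blast
  then show thesis using that Q by blast
qed

section \<open>Chains of primes produced by regular sequences\<close>

lemma prime_idealD:
  assumes "prime_ideal P"
  shows "is_ideal P" "1 \<notin> P" "a * b \<in> P \<Longrightarrow> a \<in> P \<or> b \<in> P"
  using assms ideal_eq_UNIV[of P] unfolding prime_ideal_def by blast+

lemma radical_prime_ideal:
  assumes "prime_ideal P" shows "radical P \<subseteq> P"
proof
  fix r assume "r \<in> radical P"
  then obtain n where "r ^ n \<in> P" unfolding radical_def by auto
  then show "r \<in> P"
  proof (induction n)
    case (Suc n)
    then show ?case using prime_idealD(3)[OF assms, of r "r ^ n"] by auto
  qed (use prime_idealD(2)[OF assms] in simp)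
qed

text \<open>A prime missing all \<open>s * y ^ n\<close> with \<open>s\<close> outside
  \<open>P\<close> lies in \<open>P\<close> (take \<open>n = 0\<close>) and omits \<open>y\<close>
  (take \<open>s = 1\<close>). No such product is in \<open>J\<close>, since cancelling
  \<open>y ^ n\<close> would put \<open>s\<close> into \<open>J\<close>, hence into
  \<open>P\<close>.\<close>

lemma exists_smaller_prime_ideal:
  assumes "noetherian_ring TYPE('a::comm_ring_1)" and P: "prime_ideal (P :: 'a set)"
    and J: "is_ideal J" "J \<subseteq> P" and y: "y \<in> P" "nonzerodivisor_mod J y"
  obtains Q where "prime_ideal Q" "J \<subseteq> Q" "Q \<subset> P"
proof -
  let ?T = "{s * y ^ n | s n. s \<notin> P}"
  have one: "1 \<in> ?T" using prime_idealD(2)[OF P] 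
    by (intro CollectI exI[of _ "1 :: 'a"] exI[of _ "0 :: nat"]) simp
  have mult: "s * t \<in> ?T" if st: "s \<in> ?T" "t \<in> ?T" for s t
  proof -
    obtain a n b k where "a \<notin> P" "b \<notin> P" "s = a * y ^ n" "t = b * y ^ k" using st by blast
    moreover from this have "s * t = (a * b) * y ^ (n + k)" by (simp add: power_add mult_ac)
    ultimately show ?thesis using prime_idealD(3)[OF P] by blast
  qed
  have disj: "J \<inter> ?T = {}"
  proof (rule ccontr)
    assume "J \<inter> ?T \<noteq> {}"
    then obtain s n where s: "s \<notin> P" "s * y ^ n \<in> J" by blast
    then have "s \<in> J"
      using nonzerodivisor_mod_power[OF y(2), of n]
      unfolding nonzerodivisor_mod_def by (simp add: mult.commute)
    then show False using s J by blast
  qed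
  obtain Q where Q: "prime_ideal Q" "J \<subseteq> Q" "Q \<inter> ?T = {}"
    using exists_prime_ideal_disjoint[OF assms(1) J(1) one mult disj] by blast
  have "Q \<subseteq> P"
  proof
    fix s assume "s \<in> Q"
    then have "s * y ^ 0 \<notin> ?T" using Q(3) by auto
    then show "s \<in> P" by blast
  qed
  moreover have "y \<in> ?T" using prime_idealD(2)[OF P]
    by (intro CollectI exI[of _ "1 :: 'a"] exI[of _ "1 :: nat"]) simp
  then have "y \<notin> Q" using Q(3) by blast
  ultimately show thesis using that Q y(1) by blast
qed

text \<open>The chain is built from the top: the last element is a nonzerodivisor modulo its
  predecessors, so \<open>P\<close> properly contains a prime over them, and induction continues
  from that prime.\<close>

lemma prime_chain_of_regular_seq:
  assumes "noetherian_ring TYPE('a::comm_ring_1)" and "prime_ideal (P :: 'a set)"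
    and "\<And>i. i < t \<Longrightarrow> nonzerodivisor_mod (ideal_gen (y ` {..<i})) (y i)"
    and "ideal_gen (y ` {..<t}) \<subseteq> P"
  shows "\<exists>C. (\<forall>i\<le>t. prime_ideal (C i)) \<and> (\<forall>i<t. C i \<subset> C (Suc i)) \<and> C t = P"
  using assms(2-)
proof (induction t arbitrary: P)
  case 0
  then show ?case by (intro exI[of _ "\<lambda>_. P"]) simp
next
  case (Suc t)
  have "y ` {..<Suc t} \<subseteq> P" by (rule subset_trans[OF ideal_gen_superset Suc.prems(3)])
  then have sub: "y ` {..<t} \<subseteq> P" and yt: "y t \<in> P" by auto
  have gen: "ideal_gen (y ` {..<t}) \<subseteq> P"
    by (rule ideal_gen_least[OF prime_idealD(1)[OF Suc.prems(1)] sub])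
  obtain Q where Q: "prime_ideal Q" "ideal_gen (y ` {..<t}) \<subseteq> Q" "Q \<subset> P"
    by (rule exists_smaller_prime_ideal[OF assms(1) Suc.prems(1) is_ideal_gen gen yt Suc.prems(2)]) auto
  then obtain C where C: "\<And>i. i \<le> t \<Longrightarrow> prime_ideal (C i)" "\<And>i. i < t \<Longrightarrow> C i \<subset> C (Suc i)" "C t = Q"
    using Suc.IH[OF Q(1) Suc.prems(2)[OF less_SucI] Q(2)] by blast
  let ?C = "C(Suc t := P)"
  have "prime_ideal (?C i)" if "i \<le> Suc t" for i
    using that C(1) Suc.prems(1) by (cases "i = Suc t") auto
  moreover have "?C i \<subset> ?C (Suc i)" if "i < Suc t" for i
    using that C(2,3) Q(3) by (cases "i = t") auto
  ultimately show ?case by (intro exI[of _ ?C]) auto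
qed

lemma local_ring_unit:
  assumes "local_ring m" "r \<notin> m"
  obtains s where "s * r = 1"
proof -
  have "ideal_gen {r} = UNIV"
    using assms is_ideal_gen[of "{r}"] ideal_gen_superset[of "{r}"] unfolding local_ring_def by blast
  moreover have "ideal_gen {r} = ideal_adjoin {0} r"
    using ideal_adjoin_gen[of "{}" r] by (simp add: ideal_gen_empty)
  ultimately have "1 \<in> ideal_adjoin {0} r" by simp
  then show thesis using that by (auto elim!: ideal_adjoinE)
qed

lemma local_ring_prime_ideal:
  assumes "local_ring m" shows "prime_ideal m"
proof -
  have m: "is_ideal m" "m \<noteq> UNIV" using assms unfolding local_ring_def by auto
  have "b \<in> m" if ab: "a * b \<in> m" and a: "a \<notin> m" for a b
  proof -
    obtain s where "s * a = 1" using local_ring_unit[OF assms a] .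
    then have "s * (a * b) = b" by (simp flip: mult.assoc)
    then show ?thesis using ideal_mult[OF m(1) ab, of s] by simp
  qed
  then show ?thesis unfolding prime_ideal_def using m by blast
qed

text \<open>If a prime \<open>Q \<noteq> m\<close> contained the sequence, the chain of primes below \<open>Q\<close> could be prolonged
  by \<open>m\<close> to one of length \<open>d + 1\<close>.\<close>

lemma radical_regular_seq:
  fixes m :: "'a::comm_ring_1 set"
  assumes "local_ring m" "regular_seq m y d" "krull_dim TYPE('a) = enat d"
  shows "radical (ideal_gen (y ` {..<d})) = m"
proof
  let ?I = "ideal_gen (y ` {..<d})"
  have m: "is_ideal m" and mP: "prime_ideal m" and noeth: "noetherian_ring TYPE('a)"
    using assms(1) local_ring_prime_ideal unfolding local_ring_def by auto
  have "?I \<subseteq> m"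
    using assms(2) unfolding regular_seq_def by (intro ideal_gen_least[OF m]) auto
  then show "radical ?I \<subseteq> m"
    using radical_mono radical_prime_ideal[OF mP] by blast
  show "m \<subseteq> radical ?I"
  proof (rule subsetI, rule ccontr)
    fix r assume r: "r \<in> m" "r \<notin> radical ?I"
    let ?T = "range (\<lambda>n. r ^ n)"
    have one: "1 \<in> ?T" by (rule range_eqI[of _ _ 0]) simp
    have mult: "s * t \<in> ?T" if "s \<in> ?T" "t \<in> ?T" for s t
      using that by (auto simp flip: power_add)
    have disj: "?I \<inter> ?T = {}" using r(2) unfolding radical_def by blast
    obtain Q where Q: "prime_ideal Q" "?I \<subseteq> Q" "Q \<inter> ?T = {}"
      using exists_prime_ideal_disjoint[OF noeth is_ideal_gen one mult disj] by blast
    have "r \<in> ?T" by (rule range_eqI[of _ _ 1]) simp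
    then have "r \<notin> Q" using Q(3) by blast
    moreover have "Q \<subseteq> m" using Q(1) assms(1) unfolding prime_ideal_def local_ring_def by blast
    ultimately have "Q \<subset> m" using r by blast
    have "nonzerodivisor_mod (ideal_gen (y ` {..<i})) (y i)" if "i < d" for i
      using assms(2) that unfolding regular_seq_def nonzerodivisor_mod_def by blast
    from prime_chain_of_regular_seq[OF noeth Q(1) this Q(2)]
    obtain C where C: "\<And>i. i \<le> d \<Longrightarrow> prime_ideal (C i)" "\<And>i. i < d \<Longrightarrow> C i \<subset> C (Suc i)" "C d = Q"
      by blast
    let ?C = "C(Suc d := m)"
    have "prime_ideal (?C i)" if "i \<le> Suc d" for i
      using that C(1) mP by (cases "i = Suc d") auto
    moreover have "?C i \<subset> ?C (Suc i)" if "i < Suc d" for i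
      using that C(2,3) \<open>Q \<subset> m\<close> by (cases "i = d") auto
    ultimately have "enat (Suc d) \<le> krull_dim TYPE('a)"
      unfolding krull_dim_def by (intro Sup_upper CollectI exI[of _ "Suc d"] conjI refl exI[of _ ?C]) auto
    then show False using assms(3) by simp
  qed
qed

section \<open>Finite colength\<close>

text \<open>A composition series from \<open>I\<close> up to the ring: for the maximal ideal
  \<open>m\<close>, each factor \<open>(I + z)/I\<close> is a copy of the residue field. Its
  induction rule serves both the bound on lengths and the inclusion of a power of \<open>m\<close>
  in \<open>I\<close>.\<close>

inductive finite_colength :: "'a::comm_ring_1 set \<Rightarrow> 'a set \<Rightarrow> bool" for m where
  UNIV: "finite_colength m UNIV"
| socle: "\<lbrakk>is_ideal I; z \<notin> I; \<And>a. a \<in> m \<Longrightarrow> a * z \<in> I; finite_colength m (ideal_adjoin I z)\<rbrakk> \<Longrightarrow>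
    finite_colength m I"

text \<open>Multiply \<open>z\<close> by the highest power of \<open>f\<close> that leaves it
  outside \<open>I\<close>. Multiples of \<open>z\<close> are still carried into \<open>I\<close> by
  the elements treated earlier.\<close>

lemma exists_socle_element:
  assumes "is_ideal I" "1 \<notin> I" "finite F" "F \<subseteq> radical I"
  shows "\<exists>z. z \<notin> I \<and> (\<forall>a\<in>F. a * z \<in> I)"
  using assms(3,4)
proof (induction F)
  case empty
  then show ?case using assms(2) by auto
next
  case (insert f F)
  then obtain z where z: "z \<notin> I" "\<And>a. a \<in> F \<Longrightarrow> a * z \<in> I" by auto
  obtain n where "f ^ n \<in> I" using insert.prems unfolding radical_def by auto
  then have ex: "f ^ n * z \<in> I" by (rule ideal_mult_right[OF assms(1)])
  define k where "k = (LEAST k. f ^ k * z \<in> I)"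
  have k: "f ^ k * z \<in> I" unfolding k_def by (rule LeastI[of "\<lambda>k. f ^ k * z \<in> I", OF ex])
  have "k \<noteq> 0" using k z(1) by (metis mult_1 power_0)
  then obtain j where j: "k = Suc j" by (cases k) auto
  have "f ^ j * z \<notin> I" using not_less_Least[of j "\<lambda>k. f ^ k * z \<in> I"] j unfolding k_def by simp
  moreover have "a * (f ^ j * z) \<in> I" if "a \<in> F" for a
    using ideal_mult[OF assms(1) z(2)[OF that], of "f ^ j"] by (simp add: mult_ac)
  moreover have "f * (f ^ j * z) \<in> I" using k j by (simp add: mult_ac)
  ultimately show ?case by blast
qed

lemma finite_colengthI:
  fixes m :: "'a::comm_ring_1 set"
  assumes "local_ring m" "is_ideal I" "m \<subseteq> radical I"
  shows "finite_colength m I"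
proof -
  have noeth: "noetherian_ring TYPE('a)" and m: "is_ideal m"
    using assms(1) unfolding local_ring_def by auto
  obtain F where F: "finite F" "m = ideal_gen F"
    using noeth m unfolding noetherian_ring_def by blast
  show ?thesis
    using assms(2,3)
  proof (induction I rule: wf_induct_rule[OF noetherian_wf[OF noeth]])
    case (1 I)
    note I = 1(2)
    show ?case
    proof (cases "1 \<in> I")
      case True
      then show ?thesis using ideal_eq_UNIV[OF I] finite_colength.UNIV by simp
    next
      case False
      have "F \<subseteq> radical I" using 1(3) F(2) ideal_gen_superset by blast
      then obtain z where z: "z \<notin> I" "\<forall>a\<in>F. a * z \<in> I"
        using exists_socle_element[OF I False F(1)] by blast
      have "is_ideal {a. a * z \<in> I}"
        using ideal_zero[OF I] ideal_add[OF I] ideal_mult[OF I]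
        by (intro is_idealI) (simp_all add: distrib_right mult.assoc)
      then have mz: "a * z \<in> I" if "a \<in> m" for a
        using ideal_gen_least[of _ F] F(2) z(2) that by blast
      have "I \<subset> ideal_adjoin I z"
        using ideal_adjoin_superset ideal_adjoin_self[OF I] z(1) by blast
      then have "finite_colength m (ideal_adjoin I z)"
        using 1(3) radical_mono[of I "ideal_adjoin I z"] is_ideal_adjoin[OF I] I
        by (intro 1(1)) auto
      then show ?thesis using finite_colength.socle[OF I z(1) mz] by blast
    qed
  qed
qed

text \<open>Adjoining the socle element \<open>z\<close> costs a chain at most one step. The ends of
  the chain are left free above \<open>I\<close>, because the modified chain has other ends.\<close>

lemma finite_colength_chain_bound:
  fixes m :: "'a::comm_ring_1 set"
  assumes "local_ring m" "finite_colength m I"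
  shows "\<exists>B. \<forall>J n. I \<subseteq> J 0 \<and> (\<forall>i\<le>n. is_ideal (J i)) \<and> (\<forall>i<n. J i \<subset> J (Suc i)) \<longrightarrow> n \<le> B"
  using assms(2)
proof induction
  case UNIV
  have "n = 0" if "UNIV \<subseteq> J 0" "\<forall>i<n. J i \<subset> J (Suc i)" for J :: "nat \<Rightarrow> 'a set" and n
    using that by (cases n) (simp, blast)
  then show ?case by (metis le0)
next
  case (socle I z)
  then obtain B where B: "\<And>J n. ideal_adjoin I z \<subseteq> J 0 \<Longrightarrow> (\<And>i. i \<le> n \<Longrightarrow> is_ideal (J i)) \<Longrightarrow>
      (\<And>i. i < n \<Longrightarrow> J i \<subset> J (Suc i)) \<Longrightarrow> n \<le> B" by metis
  have "n \<le> Suc B"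
    if J0: "I \<subseteq> J 0" and id: "\<forall>i\<le>n. is_ideal (J i)" and J: "\<forall>i<n. J i \<subset> J (Suc i)" for J n
  proof (cases n)
    case (Suc l)
    have IJ: "I \<subseteq> J i" if "i \<le> n" for i
      using that
    proof (induction i)
      case (Suc i)
      then show ?case using J by (meson Suc_leD Suc_le_lessD order.strict_implies_order order.trans)
    qed (rule J0)
    \<comment> \<open>Terms before \<open>z\<close> enters get \<open>z\<close> adjoined; once
      \<open>z\<close> lies in the next term, that term is taken instead. Only indices up to
      \<open>l = n - 1\<close> are used.\<close>
    define J' where "J' i = (if z \<in> J (Suc i) then J (Suc i) else ideal_adjoin (J i) z)" for i
    \<comment> \<open>If \<open>w = j + r * z\<close>, then either \<open>r\<close> is in
      \<open>m\<close> and \<open>r * z\<close> falls into \<open>I\<close>, so that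
      \<open>w\<close> is in \<open>J i\<close>, or \<open>r\<close> is a unit and \<open>z\<close>
      would lie in \<open>J (Suc i)\<close>.\<close>
    have strict: "ideal_adjoin (J i) z \<subset> ideal_adjoin (J (Suc i)) z" if i: "i < n" "z \<notin> J (Suc i)" for i
    proof -
      have ids: "is_ideal (J i)" "is_ideal (J (Suc i))" using id i(1) by auto
      obtain w where w: "w \<in> J (Suc i)" "w \<notin> J i" using J i(1) by blast
      have "w \<notin> ideal_adjoin (J i) z"
      proof
        assume "w \<in> ideal_adjoin (J i) z"
        then obtain j r where jr: "j \<in> J i" "w = j + r * z" by (metis ideal_adjoinE)
        show False
        proof (cases "r \<in> m")
          case True
          then have "r * z \<in> J i" using socle.hyps(3) IJ[of i] i(1) by auto
          then show False using jr w(2) ideal_add[OF ids(1)] by blast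
        next
          case False
          then obtain s where "s * r = 1" using local_ring_unit[OF assms(1)] by blast
          then have "z = s * (w - j)" using jr(2) by (simp flip: mult.assoc)
          moreover have "j \<in> J (Suc i)" using jr(1) J i(1) by blast
          ultimately have "z \<in> J (Suc i)" using ideal_mult[OF ids(2) ideal_diff[OF ids(2) w(1)]] by blast
          then show False using i(2) by blast
        qed
      qed
      moreover have "w \<in> ideal_adjoin (J (Suc i)) z" using w(1) ideal_adjoin_superset by blast
      moreover have "ideal_adjoin (J i) z \<subseteq> ideal_adjoin (J (Suc i)) z"
        using J i(1) unfolding ideal_adjoin_def by blast
      ultimately show ?thesis by blast
    qed
    have "l \<le> B"
    proof (rule B[of J'])
      have "I \<subseteq> J (Suc 0)" using IJ[of "Suc 0"] Suc by simp
      moreover have "is_ideal (J (Suc 0))" using id Suc by simp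
      ultimately show "ideal_adjoin I z \<subseteq> J' 0"
        unfolding J'_def using J0 ideal_adjoin_least[of "J (Suc 0)" I z]
        by (auto elim!: ideal_adjoinE intro!: ideal_adjoinI)
    next
      fix i assume "i \<le> l"
      then show "is_ideal (J' i)" unfolding J'_def using id Suc by (auto intro!: is_ideal_adjoin)
    next
      fix i assume "i < l"
      then have i: "i < n" "Suc i < n" using Suc by auto
      then have sub: "J (Suc i) \<subset> J (Suc (Suc i))" using J by blast
      show "J' i \<subset> J' (Suc i)"
      proof (cases "z \<in> J (Suc i)")
        case True
        then show ?thesis unfolding J'_def using sub by auto
      next
        case False
        have "ideal_adjoin (J (Suc i)) z \<subseteq> J' (Suc i)"
        proof (cases "z \<in> J (Suc (Suc i))")
          case True
          moreover have "is_ideal (J (Suc (Suc i)))" using id i(2) by simp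
          ultimately show ?thesis unfolding J'_def using sub ideal_adjoin_least by auto
        qed (simp add: J'_def)
        moreover have "J' i = ideal_adjoin (J i) z" unfolding J'_def using False by simp
        ultimately show ?thesis using strict[OF i(1) False] by blast
      qed
    qed
    then show ?thesis using Suc by simp
  qed simp
  then show ?case by blast
qed

lemma length_quot_finite:
  assumes "local_ring m" "finite_colength m I"
  shows "length_quot I \<noteq> \<infinity>"
proof -
  obtain B where B: "\<And>J n. I \<subseteq> J 0 \<Longrightarrow> \<forall>i\<le>n. is_ideal (J i) \<Longrightarrow> \<forall>i<n. J i \<subset> J (Suc i) \<Longrightarrow> n \<le> B"
    using finite_colength_chain_bound[OF assms] by blast
  have "length_quot I \<le> enat B"
    unfolding length_quot_def by (rule Sup_least) (auto intro!: B)
  then show ?thesis by (metis infinity_ileE)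
qed

section \<open>Powers of \<open>m\<close> and finiteness of orders\<close>

lemma is_ideal_pow: "is_ideal (ideal_pow m k)"
  by (cases k) (simp_all add: is_ideal_UNIV ideal_prod_def is_ideal_gen)

lemma ideal_prod_least:
  "is_ideal K \<Longrightarrow> (\<And>a b. a \<in> I \<Longrightarrow> b \<in> J \<Longrightarrow> a * b \<in> K) \<Longrightarrow> ideal_prod I J \<subseteq> K"
  unfolding ideal_prod_def by (rule ideal_gen_least) auto

lemma ideal_pow_antimono: "k \<le> l \<Longrightarrow> ideal_pow m l \<subseteq> ideal_pow m k"
proof (induction rule: dec_induct)
  case (step l)
  have "ideal_pow m (Suc l) \<subseteq> ideal_pow m l"
    by (simp add: ideal_prod_least is_ideal_pow ideal_mult)
  then show ?case using step.IH by blast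
qed simp

text \<open>Every socle step costs one further factor \<open>m\<close>, because \<open>m\<close>
  carries \<open>I + (z)\<close> into \<open>I\<close>.\<close>

lemma finite_colength_ideal_pow:
  assumes "finite_colength m I"
  shows "\<exists>N. ideal_pow m N \<subseteq> I"
  using assms
proof induction
  case UNIV
  then show ?case by auto
next
  case (socle I z)
  then obtain N where N: "ideal_pow m N \<subseteq> ideal_adjoin I z" by blast
  have "a * b \<in> I" if a: "a \<in> m" and b: "b \<in> ideal_pow m N" for a b
  proof -
    obtain j r where "j \<in> I" "b = j + r * z" using N b by (metis ideal_adjoinE subsetD)
    moreover have "a * (j + r * z) = a * j + r * (a * z)" by (simp add: algebra_simps)
    ultimately show ?thesis
      using ideal_add[OF socle(1) ideal_mult[OF socle(1)] ideal_mult[OF socle(1) socle(3)[OF a]]] by simp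
  qed
  then have "ideal_pow m (Suc N) \<subseteq> I" using ideal_prod_least[OF socle(1)] by simp
  then show ?case by blast
qed

lemma ord_quot_finite:
  assumes "is_ideal I" "finite_colength m I" "x \<notin> I"
  shows "ord_quot m I x \<noteq> \<infinity>"
proof -
  obtain N where N: "ideal_pow m N \<subseteq> I" using finite_colength_ideal_pow[OF assms(2)] by blast
  have "k \<le> N" if k: "x \<in> ideal_sum (ideal_pow m k) I" for k
  proof (rule ccontr)
    assume "\<not> k \<le> N"
    then have "ideal_pow m k \<subseteq> I" using N ideal_pow_antimono[of N k m] by auto
    then show False using k assms(3) ideal_add[OF assms(1)] unfolding ideal_sum_def by blast
  qed
  then have "ord_quot m I x \<le> enat N" unfolding ord_quot_def by (intro Sup_least) auto
  then show ?thesis by (metis infinity_ileE)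
qed

lemma ord_quot_eq_infinity:
  assumes "x \<in> I" shows "ord_quot m I x = \<infinity>"
proof (cases "ord_quot m I x")
  case (enat n)
  have "x \<in> ideal_sum (ideal_pow m (Suc n)) I"
    unfolding ideal_sum_def using assms ideal_zero[OF is_ideal_pow[of m "Suc n"]]
    by (intro CollectI exI[of _ 0] exI[of _ x]) simp
  then have "enat (Suc n) \<le> ord_quot m I x" unfolding ord_quot_def by (intro Sup_upper) blast
  then show ?thesis using enat by simp
qed simp

section \<open>Frobenius powers of parameter ideals\<close>

lemma power_mem_frob_pow: "r \<in> I \<Longrightarrow> r ^ q \<in> frob_pow I q"
  unfolding frob_pow_def by (rule subsetD[OF ideal_gen_superset imageI])

lemma frob_pow_one: "is_ideal I \<Longrightarrow> frob_pow I 1 = I"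
  unfolding frob_pow_def by (simp add: ideal_gen_ideal)

text \<open>The preimage of an ideal under Frobenius is an ideal, so it suffices to test the
  generators \<open>r ^ q\<close>.\<close>

lemma frob_pow_power_char:
  fixes s :: "'a::comm_ring_1"
  assumes p: "prime CHAR('a)" and "s \<in> frob_pow I q"
  shows "s ^ CHAR('a) \<in> frob_pow I (q * CHAR('a))"
proof -
  let ?p = "CHAR('a)"
  have K: "is_ideal (frob_pow I (q * ?p))" unfolding frob_pow_def by (rule is_ideal_gen)
  have "is_ideal {s. s ^ ?p \<in> frob_pow I (q * ?p)}"
    using p ideal_zero[OF K] ideal_add[OF K] ideal_mult[OF K]
    by (intro is_idealI) (simp_all add: freshmans_dream power_mult_distrib power_0_left)
  moreover have "(\<lambda>r. r ^ q) ` I \<subseteq> {s. s ^ ?p \<in> frob_pow I (q * ?p)}"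
    using power_mem_frob_pow[of _ I "q * ?p"] by (auto simp: power_mult)
  ultimately have "frob_pow I q \<subseteq> {s. s ^ ?p \<in> frob_pow I (q * ?p)}"
    by (subst frob_pow_def) (rule ideal_gen_least)
  then show ?thesis using assms(2) by blast
qed

lemma fte_le_zeroD:
  assumes "fte p I \<le> 0" "is_ideal I"
  shows "frob_closure p I \<subseteq> I"
proof -
  \<comment> \<open>An infimum strictly below 1 has a member below 1, which must be the exponent
    0.\<close>
  have "fte p I < enat 1" using assms(1) by (simp add: zero_enat_def le_less_trans)
  then have "\<forall>e\<ge>0. frob_pow (frob_closure p I) (p ^ e) = frob_pow I (p ^ e)"
    unfolding fte_def Inf_less_iff by auto
  then have "frob_pow (frob_closure p I) (p ^ 0) = frob_pow I (p ^ 0)" by blast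
  then have "frob_pow (frob_closure p I) 1 = I"
    using frob_pow_one[OF assms(2)] by simp
  then show ?thesis using power_mem_frob_pow[of _ "frob_closure p I" 1] by auto
qed

text \<open>If \<open>r ^ p \<in> I^[p]\<close> then \<open>r ^ (p ^ e)\<close> has infinite order for every \<open>e \<ge> 1\<close>. The minimum is
  finite if \<open>r \<notin> I\<close>, so it is attained at \<open>e = 0\<close>, where \<open>fte I = 0\<close> forces \<open>I\<close> to be Frobenius closed.\<close>

lemma parameter_ideal_frobenius_reflecting:
  fixes m :: "'a::comm_ring_1 set"
  defines "p \<equiv> CHAR('a)"
  assumes m: "local_ring m" and p: "prime CHAR('a)"
    and I: "is_ideal I" "m \<subseteq> radical I" and num: "numerical_fun2 \<phi>"
    and bound: "Inf {ord_quot m (frob_pow I (p ^ e)) (r ^ (p ^ e)) | e. enat e \<ge> fte p I}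
      \<le> \<phi> (length_quot I) (ord_quot m I r)"
    and r: "r ^ p \<in> frob_pow I p"
  shows "r \<in> I"
proof (rule ccontr)
  assume "r \<notin> I"
  have fin: "finite_colength m I" by (rule finite_colengthI[OF m I])
  have "\<phi> (length_quot I) (ord_quot m I r) \<noteq> \<infinity>"
    using num length_quot_finite[OF m fin] ord_quot_finite[OF I(1) fin \<open>r \<notin> I\<close>]
    unfolding numerical_fun2_def by simp
  then have "Inf {ord_quot m (frob_pow I (p ^ e)) (r ^ (p ^ e)) | e. enat e \<ge> fte p I} < \<infinity>"
    by (intro le_less_trans[OF bound]) simp
  \<comment> \<open>In \<open>enat\<close> the infimum of the empty set is infinite, so a finite
    infimum also shows that \<open>fte p I\<close> is finite.\<close>
  then obtain e where e: "fte p I \<le> enat e" "ord_quot m (frob_pow I (p ^ e)) (r ^ (p ^ e)) \<noteq> \<infinity>"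
    unfolding Inf_less_iff by (blast dest: less_imp_neq)
  have pos: "r ^ (p ^ Suc l) \<in> frob_pow I (p ^ Suc l)" for l
  proof (induction l)
    case (Suc l)
    have "(r ^ (p ^ Suc l)) ^ p \<in> frob_pow I (p ^ Suc l * p)"
      using frob_pow_power_char[OF p] Suc unfolding p_def by blast
    then show ?case by (simp only: power_Suc2[of p "Suc l"] power_mult)
  qed (use r in simp)
  have "e = 0"
    using e(2) ord_quot_eq_infinity[OF pos, of m] by (cases e) auto
  then have "frob_closure p I \<subseteq> I" using e(1) I(1) by (intro fte_le_zeroD) (simp_all add: zero_enat_def)
  moreover have "r \<in> frob_closure p I"
    unfolding frob_closure_def
  proof (intro CollectI exI[of _ 1] allI impI)
    fix e :: nat assume "e \<ge> 1"
    then show "r ^ (p ^ e) \<in> frob_pow I (p ^ e)" using pos[of "e - 1"] by simp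
  qed
  ultimately show False using \<open>r \<notin> I\<close> by blast
qed

section \<open>Injectivity of Frobenius\<close>

lemma depth_less_frob_injective:
  fixes m :: "'a::comm_ring_1 set"
  assumes "prime CHAR('a)" "enat i < depth m" "ideal_gen (x ` {..<n}) = m"
  shows "frob_injective_cech p x n i"
proof -
  obtain y t where y: "regular_seq m y t" "i < t"
    using assms(2) unfolding depth_def less_Sup_iff by auto
  have "set (map y [0..<t]) \<subseteq> m" using y(1) unfolding regular_seq_def by auto
  then show ?thesis
    using weakly_regular_of_regular_seq[OF y(1)] y(2) assms(3)
    by (intro frob_injective_cechI cech_vanishing[OF assms(1) _ is_ideal_zero, of "map y [0..<t]"]) auto
qed

text \<open>A finite positive supremum of naturals is attained. For depth 0 the empty sequence has
  to be regular, that is, the zero ideal proper.\<close>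

lemma depth_attained:
  fixes m :: "'a::comm_ring_1 set"
  assumes "local_ring m" "depth m = enat d"
  shows "\<exists>y. regular_seq m y d"
proof (cases d)
  case 0
  have "0 \<in> m" using assms(1) ideal_zero unfolding local_ring_def by auto
  moreover have "1 \<notin> m" using prime_idealD(2)[OF local_ring_prime_ideal[OF assms(1)]] .
  ultimately have "{0} \<noteq> (UNIV :: 'a set)" by (metis UNIV_I singletonD)
  then have "regular_seq m y 0" for y
    unfolding regular_seq_def by (simp add: ideal_gen_empty)
  then show ?thesis using 0 by blast
next
  case (Suc d')
  have "enat d' < depth m" using assms(2) Suc by simp
  then obtain y t where yt: "regular_seq m y t" "d' < t"
    unfolding depth_def less_Sup_iff by auto
  have "enat t \<le> depth m" unfolding depth_def using yt(1) by (intro Sup_upper) blast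
  then have "t = d" using yt(2) Suc assms(2) by simp
  then show ?thesis using yt(1) by blast
qed

text \<open>The exponents met in the descent are not known beforehand, so every list of positive
  powers has to be a system of parameters.\<close>

lemma radical_powers:
  fixes m :: "'a::comm_ring_1 set"
  assumes p: "prime CHAR('a)" and m: "prime_ideal m" and ys: "radical (ideal_gen (set ys)) = m"
    and zs: "list_all2 (\<lambda>z y. \<exists>K>0. z = y ^ K) zs ys"
  shows "set zs \<subseteq> m" "radical (ideal_gen (set zs)) = m"
proof -
  have ysm: "set ys \<subseteq> m"
  proof
    fix y assume "y \<in> set ys"
    then have "y ^ 1 \<in> ideal_gen (set ys)" using ideal_gen_superset by auto
    then show "y \<in> m" using ys unfolding radical_def by blast
  qed
  show zsm: "set zs \<subseteq> m"
  proof
    fix z assume "z \<in> set zs"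
    then obtain i where i: "i < length zs" "z = zs ! i" by (auto simp: in_set_conv_nth)
    then obtain K where K: "K > 0" "z = (ys ! i) ^ K" using list_all2_nthD[OF zs i(1)] by blast
    have "ys ! i \<in> m" using i(1) ysm list_all2_lengthD[OF zs] by auto
    then show "z \<in> m" using ideal_pow_mono[OF prime_idealD(1)[OF m], of "ys ! i" 1 K] K by simp
  qed
  let ?R = "radical (ideal_gen (set zs))"
  have "set ys \<subseteq> ?R"
  proof
    fix y assume "y \<in> set ys"
    then obtain i where i: "i < length ys" "y = ys ! i" by (auto simp: in_set_conv_nth)
    then have iz: "i < length zs" using list_all2_lengthD[OF zs] by simp
    then obtain K where "zs ! i = y ^ K" using list_all2_nthD[OF zs iz] i(2) by blast
    moreover have "zs ! i \<in> ideal_gen (set zs)" using iz ideal_gen_superset nth_mem by blast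
    ultimately have "y ^ K \<in> ideal_gen (set zs)" by simp
    then show "y \<in> ?R" unfolding radical_def by blast
  qed
  then have "ideal_gen (set ys) \<subseteq> ?R"
    by (rule ideal_gen_least[OF is_ideal_radical[OF p is_ideal_gen]])
  then have "m \<subseteq> ?R" using radical_mono[of _ ?R] radical_idem ys by blast
  moreover have "?R \<subseteq> m"
    using radical_mono[OF ideal_gen_least[OF prime_idealD(1)[OF m] zsm]] radical_prime_ideal[OF m] by blast
  ultimately show "?R = m" by blast
qed

theorem theorem4p6:
  fixes m :: "'a::comm_ring_1 set" and p :: nat
  assumes "cohen_macaulay_local m"
    and "prime p" and "CHAR('a) = p"
    and "\<exists>\<phi>. numerical_fun2 \<phi> \<and>
           (\<forall>(x::'a) I. parameter_ideal m I \<longrightarrow>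
              Inf {ord_quot m (frob_pow I (p ^ e)) (x ^ (p ^ e)) | e. enat e \<ge> fte p I}
                \<le> \<phi> (length_quot I) (ord_quot m I x))"
  shows "F_injective p m"
  unfolding F_injective_def
proof (intro allI impI)
  fix i n and x :: "nat \<Rightarrow> 'a"
  assume i: "enat i \<le> krull_dim TYPE('a)" and x: "ideal_gen (x ` {..<n}) = m"
  have m: "local_ring m" and depth: "depth m = krull_dim TYPE('a)"
    using assms(1) unfolding cohen_macaulay_local_def by auto
  have p: "prime CHAR('a)" and p0: "p > 0" using assms(2,3) prime_gt_0_nat by auto
  show "frob_injective_cech p x n i"
  proof (cases "enat i < depth m")
    case True
    then show ?thesis using depth_less_frob_injective[OF p _ x] by blast
  next
    case False
    then have dim: "depth m = enat i" "krull_dim TYPE('a) = enat i" using i depth by auto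
    obtain y where y: "regular_seq m y i" using depth_attained[OF m dim(1)] by blast
    define ys where "ys = map y [0..<i]"
    have len: "length ys = i" and set: "set ys = y ` {..<i}" unfolding ys_def by auto
    have ysm: "set ys \<subseteq> m" using y unfolding set regular_seq_def by auto
    have reg: "weakly_regular {0} ys" unfolding ys_def by (rule weakly_regular_of_regular_seq[OF y])
    have rad: "radical (ideal_gen (set ys)) = m"
      unfolding set by (rule radical_regular_seq[OF m y dim(2)])
    obtain \<phi> where num: "numerical_fun2 \<phi>" and bound: "\<And>(x::'a) I. parameter_ideal m I \<Longrightarrow>
        Inf {ord_quot m (frob_pow I (p ^ e)) (x ^ (p ^ e)) | e. enat e \<ge> fte p I}
          \<le> \<phi> (length_quot I) (ord_quot m I x)"
      using assms(4) by blast
    have reflect: "r \<in> foldl ideal_adjoin {0} zs"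
      if zs: "list_all2 (\<lambda>z y. \<exists>K>0. z = y ^ K) zs ys"
        and r: "r ^ p \<in> foldl ideal_adjoin {0} (map (\<lambda>z. z ^ p) zs)" for zs r
    proof -
      define I where "I = ideal_gen (set zs)"
      note R = radical_powers[OF p local_ring_prime_ideal[OF m] rad zs]
      have lz: "length zs = i" using list_all2_lengthD[OF zs] len by simp
      have img: "(!) zs ` {..<i} = set zs"
        using lz by (auto simp: in_set_conv_nth)
      have "system_of_parameters m ((!) zs) i"
        unfolding system_of_parameters_def img using R dim(2) lz by auto
      then have par: "parameter_ideal m I" unfolding parameter_ideal_def I_def using img by metis
      have I: "is_ideal I" unfolding I_def by (rule is_ideal_gen)
      \<comment> \<open>What matters is that the ideal of the \<open>z ^ p\<close> is contained in
        \<open>I^[p]\<close>, since \<open>r ^ p\<close> has to be moved into the latter.\<close>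
      have "set (map (\<lambda>z. z ^ p) zs) \<subseteq> frob_pow I p"
        using ideal_gen_superset[of "set zs"] unfolding I_def by (auto intro!: power_mem_frob_pow)
      then have "ideal_gen (set (map (\<lambda>z. z ^ p) zs)) \<subseteq> frob_pow I p"
        unfolding frob_pow_def by (rule ideal_gen_least[OF is_ideal_gen])
      then have "r ^ p \<in> frob_pow I p"
        using r foldl_adjoin_gen[of "{}" "map (\<lambda>z. z ^ p) zs"] by (auto simp: ideal_gen_empty)
      moreover have "m \<subseteq> radical I" using R(2) unfolding I_def by simp
      ultimately have "r \<in> I"
        using parameter_ideal_frobenius_reflecting[OF m p I _ num, unfolded assms(3), OF _ bound[OF par]]
        by simp
      then show ?thesis
        using foldl_adjoin_gen[of "{}" zs] by (simp add: I_def ideal_gen_empty)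
    qed
    show ?thesis
    proof (rule frob_injective_cechI)
      fix a k
      assume "strict_cocycle x n {0} i k a" "coboundary_mod x n {0} i (k * p) (\<lambda>S. a S ^ p)"
      \<comment> \<open>Both towers of quotients start at the zero ideal, as
        \<open>0 ^ p = 0\<close>.\<close>
      then show "coboundary_mod x n {0} i k a"
        using cech_frobenius_descent[OF p, of ys x n "{0}" "{0}" k a] ysm x reg p0 reflect
          weakly_regular_map_power[OF is_ideal_zero reg p0]
        by (simp add: len assms(3) is_ideal_zero power_0_left)
    qed
  qed
qed

end
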